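(* Let $G_m=([n],E_m)$ be the random graph process and $\tau_1=\min\{m:\delta(G_m)\ge1\}$. Color each edge of $G_{\tau_1}$ black or white independently and uniformly at random. Then with high probability, for every pair of distinct vertices $x,y\in[n]$ there is a zebraic path in $G_{\tau_1}$ joining $x$ and $y$.
   Context: The random graph process: $E_0=\emptyset$ and $E_m=E_{m-1}\cup\{e_m\}$ where $e_m$ is chosen uniformly at random among the edges of $K_n$ not in $E_{m-1}$. A path in a black/white edge-colored graph is zebraic if the colors of its edges alternate along it. "With high probability" means with probability $1-o(1)$ as $n\to\infty$. *)

theory Defs
  imports "HOL-Probability.Probability" "HOL-Combinatorics.Multiset_Permutations"
begin

definition Kn_edges :: "nat \<Rightarrow> nat set set" where
  "Kn_edges n = {{x, y} | x y. x < n \<and> y < n \<and> x \<noteq> y}"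

definition min_deg_ge1 :: "nat \<Rightarrow> nat set set \<Rightarrow> bool" where
  "min_deg_ge1 n E \<longleftrightarrow> (\<forall>x<n. \<exists>e\<in>E. x \<in> e)"

(* A run of the random graph process is an ordering es = [e_1, ..., e_N] of all edges of K_n;
   E_m = set (take m es).  Hitting time tau_1 = min { m : delta(G_m) >= 1 }. *)
definition tau1 :: "nat \<Rightarrow> nat set list \<Rightarrow> nat" where
  "tau1 n es = (LEAST m. min_deg_ge1 n (set (take m es)))"

(* The random graph process: uniformly random ordering of the edges of K_n
   (equivalent to choosing each e_m uniformly among the remaining edges). *)
definition graph_process :: "nat \<Rightarrow> nat set list pmf" where
  "graph_process n = pmf_of_set (permutations_of_set (Kn_edges n))"

(* G_{tau_1} together with an independent uniform black/white colouring of its edges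
   (True = black, False = white). *)
definition coloured_hitting_graph :: "nat \<Rightarrow> (nat set set \<times> (nat set \<Rightarrow> bool)) pmf" where
  "coloured_hitting_graph n =
     bind_pmf (graph_process n) (\<lambda>es.
       let E = set (take (tau1 n es) es)
       in map_pmf (\<lambda>c. (E, c)) (pmf_of_set (PiE E (\<lambda>_. UNIV :: bool set))))"

definition is_path :: "nat \<Rightarrow> nat set set \<Rightarrow> nat list \<Rightarrow> nat \<Rightarrow> nat \<Rightarrow> bool" where
  "is_path n E vs x y \<longleftrightarrow>
     vs \<noteq> [] \<and> hd vs = x \<and> last vs = y \<and> distinct vs \<and> set vs \<subseteq> {..<n} \<and>
     (\<forall>i. Suc i < length vs \<longrightarrow> {vs ! i, vs ! Suc i} \<in> E)"

definition zebraic :: "(nat set \<Rightarrow> bool) \<Rightarrow> nat list \<Rightarrow> bool" where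
  "zebraic c vs \<longleftrightarrow>
     (\<forall>i. i + 2 < length vs \<longrightarrow> c {vs ! i, vs ! (i + 1)} \<noteq> c {vs ! (i + 1), vs ! (i + 2)})"

definition zebraic_connected :: "nat \<Rightarrow> nat set set \<Rightarrow> (nat set \<Rightarrow> bool) \<Rightarrow> bool" where
  "zebraic_connected n E c \<longleftrightarrow>
     (\<forall>x<n. \<forall>y<n. x \<noteq> y \<longrightarrow> (\<exists>vs. is_path n E vs x y \<and> zebraic c vs))"

end

theory Submission
  imports Defs "HOL-Real_Asymp.Real_Asymp"
begin

text \<open>
  Give every edge of \<open>K\<^sub>n\<close> independently a class (early with probability \<open>0.9 ln n / n\<close>,
  otherwise middle with probability \<open>2 ln n / n\<close>, otherwise late) and a fair colour. Listing the
  classes one after the other, each in uniformly random order, gives a uniformly random ordering of all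
  edges. With high probability the early graph has an isolated vertex and the early and middle edges
  together leave none, so the hitting graph lies between these two graphs.

  Chernoff bounds and first moments give the rest: vertices of low early degree are far apart and only
  have neighbours with many early edges of both colours, no vertex has three neighbours that are poor in
  some colour, sets of at most \<open>\<epsilon> n\<close> vertices are sparse, and any two disjoint sets of linear size are
  joined by early edges of both colours. Sparseness makes alternating trees double in every step, even if
  the trees of \<open>x\<close> and \<open>y\<close> are kept disjoint and away from poor vertices. Once both last layers have
  linear size, one edge (or two, if the colours of the last layers differ) joins the trees by a zebraic path.
\<close>

section \<open>Alternating paths\<close>

text \<open>The hitting time makes edges dependent, so product estimates do not apply to the hitting
  graph itself. \<open>low\<close> and \<open>poor\<close> are therefore measured in the early
  graph, trees grow along early edges after their first edge, and bad edges between exceptional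
  vertices are excluded already among early and middle edges; all this passes to every graph in
  between. A vertex may have a single edge, of either colour, so its neighbour must be rich in both
  colours.

  Constants: 0.9 ln n / n leaves about n^0.1 isolated vertices on average, while 2 ln n / n lets at
  most about 1/n survive. With degree threshold ln n / 100 the bounds for being low and poor are of
  order n^(-0.78) and n^(-0.375). Two poor neighbours of one vertex cannot be excluded by this first
  moment, three can. The density ln n / 2000 keeps 16 * (ln n / 2000) below ln n / 100 - 2 for large
  n, as expansion needs, and exp (- 8000) is small enough because 0.9 + 3 is at most 8000 /
  2000.\<close>

lemma finite_Kn_edges [simp]: "finite (Kn_edges n)"
proof -
  have "Kn_edges n \<subseteq> Pow {..<n}"
    by (auto simp: Kn_edges_def)
  then show ?thesis
    by (rule finite_subset) simp
qed

lemma Kn_edges_iff: "{x, y} \<in> Kn_edges n \<longleftrightarrow> x < n \<and> y < n \<and> x \<noteq> y"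
  by (auto simp: Kn_edges_def doubleton_eq_iff)

lemma zebraic_short [simp]: "zebraic c []" "zebraic c [a]" "zebraic c [a, b]"
  by (auto simp: zebraic_def)

lemma zebraic_Cons:
  "zebraic c (a # b # e # vs) \<longleftrightarrow> c {a, b} \<noteq> c {b, e} \<and> zebraic c (b # e # vs)"
  (is "?L \<longleftrightarrow> ?R")
proof
  assume L: ?L
  have "c {(b # e # vs) ! i, (b # e # vs) ! (i + 1)}
      \<noteq> c {(b # e # vs) ! (i + 1), (b # e # vs) ! (i + 2)}" if "i + 2 < length (b # e # vs)" for i
    using L[unfolded zebraic_def, rule_format, of "Suc i"] that by simp
  moreover have "c {a, b} \<noteq> c {b, e}"
    using L[unfolded zebraic_def, rule_format, of 0] by simp
  ultimately show ?R
    by (simp add: zebraic_def)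
next
  assume R: ?R
  show ?L
    unfolding zebraic_def
  proof (intro allI impI)
    fix i
    assume "i + 2 < length (a # b # e # vs)"
    then show "c {(a # b # e # vs) ! i, (a # b # e # vs) ! (i + 1)}
      \<noteq> c {(a # b # e # vs) ! (i + 1), (a # b # e # vs) ! (i + 2)}"
      using R by (cases i) (auto simp: zebraic_def)
  qed
qed

text \<open>The two pieces overlap in the whole edge \<open>{w, v}\<close>, so every pair of
  consecutive edges lies inside one of them. An overlap in a single vertex would lose the comparison
  there.\<close>

lemma zebraic_append:
  "zebraic c (us @ [w, v] @ vs) \<longleftrightarrow> zebraic c (us @ [w, v]) \<and> zebraic c (w # v # vs)"
proof (induction us)
  case Nil
  then show ?case by simp
next
  case (Cons a us)
  show ?case
  proof (cases us)
    case Nil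
    then show ?thesis by (simp add: zebraic_Cons)
  next
    case (Cons b us')
    then obtain e r where "us' @ [w, v] = e # r" by (cases us') auto
    then show ?thesis
      using Cons.IH Cons \<open>us = b # us'\<close>
      by (cases us') (auto simp: zebraic_Cons)
  qed
qed

lemma zebraic_rev: "zebraic c (rev vs) \<longleftrightarrow> zebraic c vs"
proof (induction vs rule: induct_list012)
  case (3 a b vs)
  show ?case
  proof (cases vs)
    case Nil
    then show ?thesis by simp
  next
    case (Cons e r)
    have "zebraic c (rev (a # b # vs)) \<longleftrightarrow> zebraic c (rev r @ [e, b] @ [a])"
      using Cons by simp
    also have "\<dots> \<longleftrightarrow> zebraic c (rev (b # vs)) \<and> zebraic c [e, b, a]"
      using Cons by (subst zebraic_append) simp
    also have "\<dots> \<longleftrightarrow> zebraic c (a # b # vs)"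
      using 3 Cons by (auto simp: zebraic_Cons insert_commute)
    finally show ?thesis .
  qed
qed auto

lemma zebraic_cong:
  assumes "is_path n E vs x y" "\<And>e. e \<in> E \<Longrightarrow> c e = c' e"
  shows "zebraic c vs \<longleftrightarrow> zebraic c' vs"
proof -
  have "c {vs ! i, vs ! (i + 1)} = c' {vs ! i, vs ! (i + 1)}
      \<and> c {vs ! (i + 1), vs ! (i + 2)} = c' {vs ! (i + 1), vs ! (i + 2)}"
    if "i + 2 < length vs" for i
  proof -
    have "{vs ! i, vs ! Suc i} \<in> E" "{vs ! Suc i, vs ! Suc (Suc i)} \<in> E"
      using assms(1) that unfolding is_path_def by auto
    then show ?thesis using assms(2) by auto
  qed
  then show ?thesis
    unfolding zebraic_def by (intro all_cong1) auto
qed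

lemma zebraic_connected_cong:
  assumes "\<And>e. e \<in> E \<Longrightarrow> c e = c' e"
  shows "zebraic_connected n E c \<longleftrightarrow> zebraic_connected n E c'"
  unfolding zebraic_connected_def using zebraic_cong[OF _ assms] by meson

lemma is_path_iff:
  "is_path n E vs x y \<longleftrightarrow> vs \<noteq> [] \<and> hd vs = x \<and> last vs = y \<and> distinct vs \<and> set vs \<subseteq> {..<n} \<and>
     successively (\<lambda>u v. {u, v} \<in> E) vs"
  by (simp add: is_path_def successively_conv_nth)

text \<open>Splitting off the last two vertices forces at least one edge and names the last one,
  whose colour decides how the path can continue. \<open>X\<close> confines the path, so that paths
  in disjoint trees can be concatenated.\<close>

definition zebraic_reach ::
  "nat \<Rightarrow> nat set set \<Rightarrow> (nat set \<Rightarrow> bool) \<Rightarrow> nat \<Rightarrow> nat set \<Rightarrow> bool \<Rightarrow> nat \<Rightarrow> bool" where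
  "zebraic_reach n E c x X a v \<longleftrightarrow>
     (\<exists>us w. is_path n E (us @ [w, v]) x v \<and> zebraic c (us @ [w, v]) \<and>
        set (us @ [w, v]) \<subseteq> X \<and> c {w, v} = a)"

lemma zebraic_reach_edge:
  assumes "{x, u} \<in> E" "x < n" "u < n" "x \<noteq> u"
  shows "zebraic_reach n E c x {x, u} (c {x, u}) u"
  unfolding zebraic_reach_def using assms
  by (intro exI[of _ "[]"] exI[of _ x]) (auto simp: is_path_iff)

lemma zebraic_reach_step:
  assumes "zebraic_reach n E c x X a v" "{v, z} \<in> E" "z < n" "z \<notin> X" "z \<in> Z" "X \<subseteq> Z" "c {v, z} \<noteq> a"
  shows "zebraic_reach n E c x Z (\<not> a) z"
proof -
  obtain us w where *: "is_path n E (us @ [w, v]) x v" "zebraic c (us @ [w, v])"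
    "set (us @ [w, v]) \<subseteq> X" "c {w, v} = a"
    using assms(1) by (auto simp: zebraic_reach_def)
  show ?thesis
    unfolding zebraic_reach_def
  proof (intro exI[of _ "us @ [w]"] exI[of _ v] conjI)
    show "zebraic c ((us @ [w]) @ [v, z])"
      using zebraic_append[of c us w v "[z]"] * assms(7) by (simp add: zebraic_Cons)
    show "is_path n E ((us @ [w]) @ [v, z]) x z"
      using *(1,3) assms by (auto simp: is_path_iff successively_append_iff hd_append)
  qed (use * assms in auto)
qed

text \<open>With the second path reversed, the new edge lies between two edges of colour
  \<open>a\<close>, so having the other colour suffices at both ends.\<close>

lemma zebraic_reach_join:
  assumes "zebraic_reach n E c x X a v" "zebraic_reach n E c y Y a v'" "X \<inter> Y = {}"
    "{v, v'} \<in> E" "c {v, v'} \<noteq> a"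
  shows "\<exists>vs. is_path n E vs x y \<and> zebraic c vs"
proof -
  obtain us w where 1: "is_path n E (us @ [w, v]) x v" "zebraic c (us @ [w, v])"
    "set (us @ [w, v]) \<subseteq> X" "c {w, v} = a"
    using assms(1) by (auto simp: zebraic_reach_def)
  obtain us' w' where 2: "is_path n E (us' @ [w', v']) y v'" "zebraic c (us' @ [w', v'])"
    "set (us' @ [w', v']) \<subseteq> Y" "c {w', v'} = a"
    using assms(2) by (auto simp: zebraic_reach_def)
  let ?vs = "us @ [w, v] @ v' # w' # rev us'"
  have rev_eq: "v' # w' # rev us' = rev (us' @ [w', v'])" by simp
  have "zebraic c (v' # w' # rev us')"
    unfolding rev_eq zebraic_rev using 2 by simp
  then have "zebraic c (w # v # v' # w' # rev us')"
    using 1(4) 2(4) assms(5) by (simp add: zebraic_Cons insert_commute)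
  then have "zebraic c ?vs"
    using 1(2) zebraic_append by blast
  moreover have "successively (\<lambda>u v. {u, v} \<in> E) (rev (us' @ [w', v']))"
    using 2(1) unfolding successively_rev is_path_iff by (simp add: insert_commute)
  then have "is_path n E ?vs x y"
    unfolding is_path_iff using 1(1,3) 2(1,3) assms(3,4)
    by (auto simp: is_path_iff successively_append_iff hd_append last_rev insert_commute
      simp flip: rev_eq split: if_splits)
  ultimately show ?thesis by blast
qed

section \<open>Growing alternating trees\<close>

definition nbrs :: "nat \<Rightarrow> nat set set \<Rightarrow> nat \<Rightarrow> nat set" where
  "nbrs n F x = {w. w < n \<and> {x, w} \<in> F}"

lemma finite_nbrs [simp]: "finite (nbrs n F x)"
  by (simp add: nbrs_def)

definition hue :: "(nat set \<Rightarrow> bool) \<Rightarrow> nat set set \<Rightarrow> bool \<Rightarrow> nat set set" where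
  "hue c F a = {e \<in> F. c e = a}"

definition low :: "nat \<Rightarrow> nat set set \<Rightarrow> real \<Rightarrow> nat \<Rightarrow> bool" where
  "low n F d x \<longleftrightarrow> real (card (nbrs n F x)) < d"

definition poor :: "nat \<Rightarrow> nat set set \<Rightarrow> (nat set \<Rightarrow> bool) \<Rightarrow> real \<Rightarrow> nat \<Rightarrow> bool" where
  "poor n F c d x \<longleftrightarrow> (\<exists>a. low n (hue c F a) d x)"

text \<open>Ordering the endpoints injects the incidences into two copies of the edges.\<close>

lemma sum_degrees_le:
  assumes "S \<subseteq> U" "finite U" "F \<subseteq> Kn_edges n"
  shows "(\<Sum>v\<in>S. card {w \<in> U. {v, w} \<in> F}) \<le> 2 * card {e \<in> F. e \<subseteq> U}"
proof -
  let ?P = "SIGMA v:S. {w \<in> U. {v, w} \<in> F}"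
  have fin: "finite S" "finite F"
    using assms finite_subset by (auto intro: finite_subset[OF assms(3)])
  have "inj_on (\<lambda>(v, w). ({v, w}, v < w)) ?P"
    using assms(3) by (auto simp: inj_on_def doubleton_eq_iff)
  moreover have "(\<lambda>(v, w). ({v, w}, v < w)) ` ?P \<subseteq> {e \<in> F. e \<subseteq> U} \<times> UNIV"
    using assms(1) by auto
  ultimately have "card ?P \<le> card ({e \<in> F. e \<subseteq> U} \<times> (UNIV :: bool set))"
    using fin by (intro card_inj_on_le) auto
  then show ?thesis
    using fin assms(2) by (simp add: card_cartesian_product)
qed

text \<open>The deterministic half of the argument: \<open>E0\<close> will be the early graph and
  \<open>E\<close> the hitting graph. Low vertices may have no edge in \<open>E0\<close>; for them
  \<open>min_deg\<close> supplies one edge of \<open>E\<close>, and \<open>low_poor\<close> makes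
  its other end a usable root.\<close>

locale spread_graph =
  fixes n :: nat and E0 E :: "nat set set" and c :: "nat set \<Rightarrow> bool" and d r eps :: real
  assumes sub: "E0 \<subseteq> E" "E \<subseteq> Kn_edges n"
    and min_deg: "min_deg_ge1 n E"
    and low_poor: "\<And>x u. {x, u} \<in> E \<Longrightarrow> low n E0 d x \<Longrightarrow> \<not> poor n E0 c d u"
    and low_low: "\<And>x y u. x \<noteq> y \<Longrightarrow> low n E0 d x \<Longrightarrow> low n E0 d y \<Longrightarrow> {x, u} \<in> E \<Longrightarrow> {y, u} \<in> E \<Longrightarrow> False"
    and few_poor: "\<And>x. card {u \<in> nbrs n E x. poor n E0 c d u} \<le> 2"
    and sparse: "\<And>U. U \<subseteq> {..<n} \<Longrightarrow> U \<noteq> {} \<Longrightarrow> real (card U) \<le> eps * n \<Longrightarrow>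
        real (card {e \<in> E0. e \<subseteq> U}) < r * card U"
    and join: "\<And>a A B. A \<subseteq> {..<n} \<Longrightarrow> B \<subseteq> {..<n} \<Longrightarrow> A \<inter> B = {} \<Longrightarrow>
        eps / 8 * n \<le> card A \<Longrightarrow> eps / 8 * n \<le> card B \<Longrightarrow> \<exists>u\<in>A. \<exists>v\<in>B. {u, v} \<in> hue c E0 a"
    and rd: "16 * r \<le> d - 2" and d4: "4 < d" and eps: "0 < eps" "eps \<le> 1 / 4" "16 \<le> eps * n"
begin

lemma edgeD: "{x, y} \<in> E \<Longrightarrow> x < n \<and> y < n \<and> x \<noteq> y"
  using sub(2) Kn_edges_iff by blast

text \<open>Each vertex of \<open>S\<close> has at least \<open>d\<close> edges of colour
  \<open>a\<close>, at most two of them to poor vertices. If fewer than \<open>2 * card S\<close>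
  new vertices \<open>N\<close> were reached, \<open>V \<union> N\<close> would have at most
  \<open>8 * card S\<close> vertices but at least \<open>(d - 2) * card S / 2\<close> early edges,
  against sparseness with \<open>16 * r \<le> d - 2\<close>.\<close>

lemma expand:
  assumes "S \<subseteq> V" "V \<subseteq> {..<n}" "card V \<le> 6 * card S" "S \<noteq> {}" "8 * card S \<le> eps * n"
    "\<And>v. v \<in> S \<Longrightarrow> \<not> poor n E0 c d v"
  obtains S' where "S' \<subseteq> {..<n} - V" "card S' = 2 * card S"
    "\<And>v. v \<in> S' \<Longrightarrow> \<not> poor n E0 c d v \<and> (\<exists>u\<in>S. {u, v} \<in> hue c E0 a)"
proof -
  define N where "N = {w. w < n \<and> w \<notin> V \<and> \<not> poor n E0 c d w \<and> (\<exists>u\<in>S. {u, w} \<in> hue c E0 a)}"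
  have "2 * card S \<le> card N"
  proof (rule ccontr)
    assume small: "\<not> 2 * card S \<le> card N"
    define U where "U = V \<union> N"
    have U: "S \<subseteq> U" "U \<subseteq> {..<n}" "U \<noteq> {}" "finite U"
      using assms by (auto simp: U_def N_def intro: finite_subset[of _ "{..<n}"])
    have "card U \<le> card V + card N"
      unfolding U_def by (rule card_Un_le)
    then have cU: "card U \<le> 8 * card S"
      using small assms(3) by linarith
    have "d - 2 \<le> real (card {w \<in> U. {v, w} \<in> E0})" if "v \<in> S" for v
    proof -
      have "nbrs n (hue c E0 a) v \<subseteq> {w \<in> U. {v, w} \<in> E0} \<union> {u \<in> nbrs n E v. poor n E0 c d u}"
        using that sub(1) by (auto simp: U_def N_def nbrs_def hue_def)
      then have "card (nbrs n (hue c E0 a) v) \<le> card ({w \<in> U. {v, w} \<in> E0} \<union> {u \<in> nbrs n E v. poor n E0 c d u})"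
        using U(4) by (intro card_mono) auto
      also have "\<dots> \<le> card {w \<in> U. {v, w} \<in> E0} + 2"
        using card_Un_le[of "{w \<in> U. {v, w} \<in> E0}" "{u \<in> nbrs n E v. poor n E0 c d u}"]
          few_poor[of v] by linarith
      finally have "card (nbrs n (hue c E0 a) v) \<le> card {w \<in> U. {v, w} \<in> E0} + 2" .
      moreover have "d \<le> card (nbrs n (hue c E0 a) v)"
        using assms(6)[OF that] by (auto simp: poor_def low_def not_less)
      ultimately show ?thesis by linarith
    qed
    then have "(\<Sum>v\<in>S. d - 2) \<le> (\<Sum>v\<in>S. real (card {w \<in> U. {v, w} \<in> E0}))"
      by (intro sum_mono)
    also have "\<dots> \<le> 2 * real (card {e \<in> E0. e \<subseteq> U})"
    proof -
      have "(\<Sum>v\<in>S. card {w \<in> U. {v, w} \<in> E0}) \<le> 2 * card {e \<in> E0. e \<subseteq> U}"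
        using sub by (intro sum_degrees_le[OF U(1,4)]) auto
      from of_nat_mono[OF this, where 'a = real] show ?thesis by simp
    qed
    also have "\<dots> < 2 * (r * card U)"
      using sparse[OF U(2,3)] cU assms(5) by linarith
    finally have *: "card S * (d - 2) < 2 * (r * card U)" by simp
    have "r * card U \<le> (d - 2) / 16 * card U"
      using rd by (intro mult_right_mono) auto
    also have "\<dots> \<le> (d - 2) / 16 * (8 * card S)"
      using cU d4 by (intro mult_left_mono) (auto simp flip: of_nat_mult)
    finally show False using * by simp
  qed
  then obtain S' where "S' \<subseteq> N" "card S' = 2 * card S"
    using obtain_subset_with_card_n by metis
  then show ?thesis
    by (intro that[of S']) (auto simp: N_def)
qed

text \<open>\<open>X\<close> and \<open>Y\<close> are the vertex sets of two alternating trees, \<open>S\<close> and \<open>T\<close> their last layers.\<close>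

definition twin_trees ::
  "nat \<Rightarrow> nat \<Rightarrow> nat \<Rightarrow> nat set \<Rightarrow> nat set \<Rightarrow> bool \<Rightarrow> nat set \<Rightarrow> nat set \<Rightarrow> bool \<Rightarrow> bool" where
  "twin_trees x y s X S a Y T b \<longleftrightarrow>
     X \<subseteq> {..<n} \<and> Y \<subseteq> {..<n} \<and> X \<inter> Y = {} \<and> S \<subseteq> X \<and> T \<subseteq> Y \<and> card S = s \<and> card T = s \<and>
     card X \<le> 2 * s \<and> card Y \<le> 2 * s \<and>
     (\<forall>v\<in>S. \<not> poor n E0 c d v \<and> zebraic_reach n E c x X a v) \<and>
     (\<forall>v\<in>T. \<not> poor n E0 c d v \<and> zebraic_reach n E c y Y b v)"

lemma reach_expand:
  assumes "\<forall>v\<in>S. zebraic_reach n E c x X a v" "S' \<subseteq> {..<n}" "S' \<inter> X = {}"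
    "\<And>v. v \<in> S' \<Longrightarrow> \<exists>u\<in>S. {u, v} \<in> hue c E0 (\<not> a)"
  shows "\<forall>v\<in>S'. zebraic_reach n E c x (X \<union> S') (\<not> a) v"
proof
  fix v
  assume v: "v \<in> S'"
  then obtain u where "u \<in> S" "{u, v} \<in> hue c E0 (\<not> a)"
    using assms(4) by blast
  then show "zebraic_reach n E c x (X \<union> S') (\<not> a) v"
    using assms(1-3) v sub(1)
    by (intro zebraic_reach_step[where v = u and X = X]) (auto simp: hue_def)
qed

text \<open>The size bound \<open>2 * s\<close> is the sum 1 + 1 + 2 + ... + s over the layers. The
  second tree must also avoid the fresh layer of the first, so 4s + 2s vertices are forbidden: this
  is the ratio 6 in \<open>expand\<close>.\<close>

lemma twin_trees_double:
  assumes "twin_trees x y s X S a Y T b" "0 < s" "8 * s \<le> eps * n"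
  shows "\<exists>X' S' a' Y' T' b'. twin_trees x y (2 * s) X' S' a' Y' T' b'"
proof -
  have X: "X \<subseteq> {..<n}" "Y \<subseteq> {..<n}" "X \<inter> Y = {}" "S \<subseteq> X" "T \<subseteq> Y" "card S = s" "card T = s"
    "card X \<le> 2 * s" "card Y \<le> 2 * s"
    "\<forall>v\<in>S. \<not> poor n E0 c d v" "\<forall>v\<in>T. \<not> poor n E0 c d v"
    "\<forall>v\<in>S. zebraic_reach n E c x X a v" "\<forall>v\<in>T. zebraic_reach n E c y Y b v"
    using assms(1) by (auto simp: twin_trees_def)
  have "card (X \<union> Y) \<le> 6 * card S"
    using X card_Un_le[of X Y] by linarith
  then obtain S' where S': "S' \<subseteq> {..<n} - (X \<union> Y)" "card S' = 2 * card S"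
    "\<And>v. v \<in> S' \<Longrightarrow> \<not> poor n E0 c d v \<and> (\<exists>u\<in>S. {u, v} \<in> hue c E0 (\<not> a))"
    using X assms by (elim expand[of S "X \<union> Y" "\<not> a", rotated -1]) auto
  have "card (X \<union> Y \<union> S') \<le> 6 * card T"
    using X S' card_Un_le[of X Y] card_Un_le[of "X \<union> Y" S'] by linarith
  then obtain T' where T': "T' \<subseteq> {..<n} - (X \<union> Y \<union> S')" "card T' = 2 * card T"
    "\<And>v. v \<in> T' \<Longrightarrow> \<not> poor n E0 c d v \<and> (\<exists>u\<in>T. {u, v} \<in> hue c E0 (\<not> b))"
    using X S' assms by (elim expand[of T "X \<union> Y \<union> S'" "\<not> b", rotated -1]) auto
  have "twin_trees x y (2 * s) (X \<union> S') S' (\<not> a) (Y \<union> T') T' (\<not> b)"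
    unfolding twin_trees_def
  proof (intro conjI)
    show "\<forall>v\<in>S'. \<not> poor n E0 c d v \<and> zebraic_reach n E c x (X \<union> S') (\<not> a) v"
      using reach_expand[OF X(12)] S' by blast
    show "\<forall>v\<in>T'. \<not> poor n E0 c d v \<and> zebraic_reach n E c y (Y \<union> T') (\<not> b) v"
      using reach_expand[OF X(13)] T' by blast
    show "card (X \<union> S') \<le> 2 * (2 * s)" "card (Y \<union> T') \<le> 2 * (2 * s)"
      using X S' T' card_Un_le[of X S'] card_Un_le[of Y T'] by linarith+
  qed (use X S' T' in auto)
  then show ?thesis by blast
qed

text \<open>Stopping at the first power of two above \<open>eps * n / 8\<close> makes the last
  layers large enough for \<open>join\<close>, while both trees together occupy at most
  \<open>eps * n\<close> vertices.\<close>

lemma large_twin_trees: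
  assumes "twin_trees x y 1 X S a Y T b"
  obtains s X S a Y T b where "twin_trees x y s X S a Y T b" "eps * n < 8 * s" "4 * s \<le> eps * n"
proof -
  let ?Q = "\<lambda>k. \<exists>X S a Y T b. twin_trees x y (2 ^ k) X S a Y T b"
  define k where "k = (LEAST k. eps * n < 8 * 2 ^ k)"
  have "\<exists>k. eps * n / 8 < (2 :: real) ^ k"
    by (rule real_arch_pow) simp
  then have "\<exists>k. eps * n < 8 * 2 ^ k"
    by (simp add: field_simps)
  then have big: "eps * n < 8 * 2 ^ k"
    unfolding k_def by (rule LeastI_ex)
  have before: "8 * 2 ^ j \<le> eps * n" if "j < k" for j
    using that not_less_Least unfolding k_def by (metis not_le)
  \<comment> \<open>As \<open>16 \<le> eps * n\<close>, at least one doubling happens, and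
    minimality of \<open>k\<close> at its predecessor gives
    \<open>4 * s \<le> eps * n\<close>.\<close>
  have "k \<noteq> 0"
    using big eps by (cases k) auto
  then obtain k' where k': "k = Suc k'" by (cases k) auto
  have "?Q j" if "j \<le> k" for j
    using that
  proof (induction j)
    case 0
    then show ?case using assms by (simp only: power_0) blast
  next
    case (Suc j)
    then obtain X S a Y T b where "twin_trees x y (2 ^ j) X S a Y T b" by auto
    from twin_trees_double[OF this] before[of j] Suc.prems show ?case by auto
  qed
  then obtain X S a Y T b where "twin_trees x y (2 ^ k) X S a Y T b" by blast
  then show ?thesis
    using big before[of k'] k' by (intro that) auto
qed

lemma path_from_large_trees:
  assumes "twin_trees x y s X S a Y T b" "eps * n < 8 * s" "4 * s \<le> eps * n"
  shows "\<exists>vs. is_path n E vs x y \<and> zebraic c vs"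
proof -
  have X: "X \<subseteq> {..<n}" "Y \<subseteq> {..<n}" "X \<inter> Y = {}" "S \<subseteq> X" "T \<subseteq> Y" "card S = s" "card T = s"
    "card X \<le> 2 * s" "card Y \<le> 2 * s"
    "\<forall>v\<in>S. zebraic_reach n E c x X a v" "\<forall>v\<in>T. zebraic_reach n E c y Y b v"
    using assms(1) by (auto simp: twin_trees_def)
  have large: "eps / 8 * n \<le> card S" "eps / 8 * n \<le> card T"
    using X assms by auto
  show ?thesis
  proof (cases "a = b")
    case True
    obtain u v where uv: "u \<in> S" "v \<in> T" "{u, v} \<in> hue c E0 (\<not> a)"
      using join[of S T "\<not> a"] X large by blast
    then show ?thesis
      using zebraic_reach_join[of n E c x X a u y Y v] X True sub by (auto simp: hue_def)
  next
    case False
    define R where "R = {..<n} - (X \<union> Y)"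
    \<comment> \<open>If the final colours differ, the first tree takes one more step outside both
      trees. No edge of colour \<open>\<not> a\<close> runs from \<open>S\<close> to
      \<open>R - A\<close>, so \<open>join\<close> makes \<open>R - A\<close> small, and
      \<open>A\<close> is nearly all of \<open>R\<close>.\<close>
    define A where "A = {r \<in> R. \<exists>u\<in>S. {u, r} \<in> hue c E0 (\<not> a)}"
    have "card (X \<union> Y) \<le> 4 * s"
      using X card_Un_le[of X Y] by linarith
    then have "real n - 4 * s \<le> card R"
      unfolding R_def using X by (subst card_Diff_subset) (auto intro: finite_subset)
    moreover have "card R = card A + card (R - A)"
    proof -
      have "finite R" "A \<subseteq> R" by (auto simp: R_def A_def)
      then show ?thesis
        by (metis card_Diff_subset card_mono finite_subset le_add_diff_inverse)
    qed
    moreover have "\<not> eps / 8 * n \<le> card (R - A)"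
    proof
      assume "eps / 8 * n \<le> card (R - A)"
      then obtain u v where "u \<in> S" "v \<in> R - A" "{u, v} \<in> hue c E0 (\<not> a)"
        using join[of S "R - A" "\<not> a"] X large unfolding R_def by blast
      then show False by (auto simp: A_def)
    qed
    moreover have "eps * n \<le> 1 / 4 * n"
      using eps by (intro mult_right_mono) auto
    ultimately have "eps / 8 * n \<le> card A"
      using assms(3) by linarith
    then obtain u v where uv: "u \<in> A" "v \<in> T" "{u, v} \<in> hue c E0 (\<not> b)"
      using join[of A T "\<not> b"] X large unfolding A_def R_def by blast
    have "\<forall>v\<in>A. zebraic_reach n E c x (X \<union> A) (\<not> a) v"
      using X(10) by (rule reach_expand) (auto simp: A_def R_def)
    \<comment> \<open>The extra step flips the final colour to \<open>\<not> a\<close>, which is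
      \<open>b\<close> since there are only two colours.\<close>
    then have "zebraic_reach n E c x (X \<union> A) b u"
      using uv False by (cases a; cases b) auto
    moreover have "(X \<union> A) \<inter> Y = {}"
      using X(3) by (auto simp: A_def R_def)
    moreover have "{u, v} \<in> E" "c {u, v} \<noteq> b"
      using uv(3) sub(1) by (auto simp: hue_def)
    ultimately show ?thesis
      using zebraic_reach_join X(11) uv(2) by blast
  qed
qed

lemma rich_nbr:
  assumes "x < n" "\<not> low n E0 d x"
  shows "\<exists>u. {x, u} \<in> E \<and> \<not> poor n E0 c d u \<and> u \<noteq> w"
proof (rule ccontr)
  assume neg: "\<not> ?thesis"
  have "nbrs n E0 x \<subseteq> {u \<in> nbrs n E x. poor n E0 c d u} \<union> {w}"
    using neg sub(1) by (auto simp: nbrs_def)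
  then have "card (nbrs n E0 x) \<le> card ({u \<in> nbrs n E x. poor n E0 c d u} \<union> {w})"
    by (intro card_mono) auto
  also have "\<dots> \<le> 3"
    using card_Un_le[of "{u \<in> nbrs n E x. poor n E0 c d u}" "{w}"] few_poor[of x] by simp
  finally show False
    using assms(2) d4 by (simp add: low_def)
qed

lemma low_nbr:
  assumes "x < n" "low n E0 d x"
  shows "\<exists>u. {x, u} \<in> E \<and> \<not> poor n E0 c d u"
proof -
  obtain e where e: "e \<in> E" "x \<in> e"
    using min_deg assms(1) by (auto simp: min_deg_ge1_def)
  then obtain u where "e = {x, u}"
    using sub(2) by (auto simp: Kn_edges_def)
  then show ?thesis
    using e low_poor[OF _ assms(2)] by blast
qed

text \<open>A low vertex may have no choice of neighbour. Two low vertices share none by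
  \<open>low_low\<close>; otherwise the vertex that is not low can avoid the neighbour taken by the
  other.\<close>

lemma distinct_rich_nbrs:
  assumes "x < n" "y < n" "x \<noteq> y"
  shows "\<exists>u w. {x, u} \<in> E \<and> {y, w} \<in> E \<and> \<not> poor n E0 c d u \<and> \<not> poor n E0 c d w \<and> u \<noteq> w"
proof (cases "low n E0 d x \<and> low n E0 d y")
  case True
  then show ?thesis
    using low_nbr[of x] low_nbr[of y] low_low[of x y] assms by metis
next
  case False
  then show ?thesis
    using low_nbr[of x] low_nbr[of y] rich_nbr[of x] rich_nbr[of y] assms by metis
qed

theorem zebraic_connected: "zebraic_connected n E c"
  unfolding zebraic_connected_def
proof (intro allI impI)
  fix x y
  assume xy: "x < n" "y < n" "x \<noteq> y"
  show "\<exists>vs. is_path n E vs x y \<and> zebraic c vs"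
  proof (cases "{x, y} \<in> E")
    case True
    then show ?thesis
      using xy by (intro exI[of _ "[x, y]"]) (auto simp: is_path_iff)
  next
    case False
    obtain u w where uw: "{x, u} \<in> E" "{y, w} \<in> E" "\<not> poor n E0 c d u" "\<not> poor n E0 c d w" "u \<noteq> w"
      using distinct_rich_nbrs[OF xy] by blast
    \<comment> \<open>Adjacent pairs were split off so that the two starting edges are
      disjoint.\<close>
    have "u \<noteq> y" "w \<noteq> x" "u < n" "w < n" "u \<noteq> x" "w \<noteq> y"
      using False uw edgeD by (auto simp: insert_commute)
    then have "twin_trees x y 1 {x, u} {u} (c {x, u}) {y, w} {w} (c {y, w})"
      unfolding twin_trees_def using uw xy by (auto intro!: zebraic_reach_edge)
    then obtain s X S a Y T b where
      "twin_trees x y s X S a Y T b" "eps * n < 8 * s" "4 * s \<le> eps * n"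
      by (rule large_twin_trees)
    then show ?thesis by (rule path_from_large_trees)
  qed
qed

end

section \<open>Coupling with independent edges\<close>

lemma permutes_between_permutations:
  assumes "xs \<in> permutations_of_set A" "ys \<in> permutations_of_set A"
  obtains \<tau> where "\<tau> permutes A" "map \<tau> xs = ys"
proof -
  have xs: "set xs = A" "distinct xs" "set ys = A" "distinct ys"
    using assms by (auto simp: permutations_of_set_def)
  have len: "length xs = length ys"
    using xs by (metis distinct_card)
  define h where "h = (!) ys \<circ> inv_into {..<length xs} ((!) xs)"
  have b: "bij_betw ((!) xs) {..<length xs} A" "bij_betw ((!) ys) {..<length xs} A"
    using xs len by (auto intro: bij_betw_nth)
  have "bij_betw h A A"
    unfolding h_def using b by (intro bij_betw_trans[OF bij_betw_inv_into]) auto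
  then have "bij_betw (\<lambda>x. if x \<in> A then h x else x) A A"
    by (rule bij_betw_cong[THEN iffD1, rotated]) simp
  then have "(\<lambda>x. if x \<in> A then h x else x) permutes A"
    by (rule bij_imp_permutes) simp
  moreover have "map (\<lambda>x. if x \<in> A then h x else x) xs = ys"
  proof (rule nth_equalityI)
    fix i
    assume "i < length (map (\<lambda>x. if x \<in> A then h x else x) xs)"
    then have i: "i < length xs" by simp
    have "inv_into {..<length xs} ((!) xs) (xs ! i) = i"
      using i b(1) by (intro inv_into_f_f) (auto simp: bij_betw_def)
    then show "map (\<lambda>x. if x \<in> A then h x else x) xs ! i = ys ! i"
      using i xs(1) by (auto simp: h_def)
  qed (simp add: len)
  ultimately show ?thesis by (rule that)
qed

text \<open>Relabelling acts transitively on the orderings of \<open>A\<close>, so an invariant law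
  gives all of them the same mass. This avoids counting the preimages of an ordering under
  \<open>arrange\<close>.\<close>

lemma pmf_of_set_permutations_eqI:
  assumes "finite A" "set_pmf M \<subseteq> permutations_of_set A"
    "\<And>\<tau>. \<tau> permutes A \<Longrightarrow> map_pmf (map \<tau>) M = M"
  shows "M = pmf_of_set (permutations_of_set A)"
proof -
  let ?P = "permutations_of_set A"
  have P: "finite ?P" "?P \<noteq> {}"
    using assms(1) by (auto simp: permutations_of_set_empty_iff)
  then obtain xs where xs: "xs \<in> ?P" by blast
  have const: "pmf M ys = pmf M xs" if ys: "ys \<in> ?P" for ys
  proof -
    obtain \<tau> where \<tau>: "\<tau> permutes A" "map \<tau> xs = ys"
      using permutes_between_permutations[OF xs ys] by blast
    have "inj (map \<tau>)"
      using permutes_inj[OF \<tau>(1)] by simp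
    then have "pmf (map_pmf (map \<tau>) M) (map \<tau> xs) = pmf M xs"
      by (rule pmf_map_inj')
    then show ?thesis
      using assms(3)[OF \<tau>(1)] \<tau>(2) by simp
  qed
  have "1 = (\<Sum>ys\<in>?P. pmf M ys)"
    using sum_pmf_eq_1[OF P(1) assms(2)] by simp
  also have "\<dots> = card ?P * pmf M xs"
    using const by simp
  finally have "pmf M xs = 1 / card ?P"
    using P by (simp add: field_simps card_gt_0_iff)
  show ?thesis
  proof (rule pmf_eqI)
    fix ys
    show "pmf M ys = pmf (pmf_of_set ?P) ys"
      using const[of ys] P assms(2) \<open>pmf M xs = _\<close>
      by (cases "ys \<in> ?P") (auto simp: indicator_def pmf_eq_0_set_pmf)
  qed
qed

text \<open>Separates the classes, which determine the ordering, from the colours, which are only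
  used once the hitting graph is known.\<close>

lemma Pi_pmf_pair:
  assumes "finite A"
  shows "Pi_pmf A (d, d') (\<lambda>x. pair_pmf (p x) (q x)) =
    map_pmf (\<lambda>(f, g) x. (f x, g x)) (pair_pmf (Pi_pmf A d p) (Pi_pmf A d' q))"
proof (rule pmf_eqI)
  fix h :: "'a \<Rightarrow> 'b \<times> 'c"
  let ?j = "\<lambda>(f, g) (x :: 'a). (f x :: 'b, g x :: 'c)"
  have "inj ?j"
    by (auto simp: inj_def fun_eq_iff)
  then have "pmf (map_pmf ?j (pair_pmf (Pi_pmf A d p) (Pi_pmf A d' q))) (?j (fst \<circ> h, snd \<circ> h)) =
      pmf (pair_pmf (Pi_pmf A d p) (Pi_pmf A d' q)) (fst \<circ> h, snd \<circ> h)"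
    by (rule pmf_map_inj')
  moreover have "?j (fst \<circ> h, snd \<circ> h) = h"
    by auto
  ultimately have "pmf (map_pmf ?j (pair_pmf (Pi_pmf A d p) (Pi_pmf A d' q))) h =
      pmf (pair_pmf (Pi_pmf A d p) (Pi_pmf A d' q)) (fst \<circ> h, snd \<circ> h)"
    by (simp only:)
  also have "\<dots> = pmf (Pi_pmf A (d, d') (\<lambda>x. pair_pmf (p x) (q x))) h"
  proof -
    have "pmf (pair_pmf (p x) (q x)) (h x) = pmf (p x) (fst (h x)) * pmf (q x) (snd (h x))" for x
      by (metis pmf_pair prod.collapse)
    then show ?thesis
      using assms by (auto simp: pmf_pair pmf_Pi prod.distrib prod_eq_iff)
  qed
  finally show "pmf (Pi_pmf A (d, d') (\<lambda>x. pair_pmf (p x) (q x))) h =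
      pmf (map_pmf ?j (pair_pmf (Pi_pmf A d p) (Pi_pmf A d' q))) h" ..
qed

text \<open>\<open>filter\<close> is stable, so each class inherits its random order from
  \<open>xs\<close>. The first flag wins, and the second decides among the remaining
  elements.\<close>

definition arrange :: "('a \<Rightarrow> bool \<times> bool) \<Rightarrow> 'a list \<Rightarrow> 'a list" where
  "arrange f xs = filter (\<lambda>x. fst (f x)) xs @ filter (\<lambda>x. \<not> fst (f x) \<and> snd (f x)) xs @
     filter (\<lambda>x. \<not> fst (f x) \<and> \<not> snd (f x)) xs"

lemma arrange_in_permutations:
  assumes "xs \<in> permutations_of_set A"
  shows "arrange f xs \<in> permutations_of_set A"
  using assms by (auto simp: permutations_of_set_def arrange_def)

text \<open>Makes the early graph and the graph of early and middle edges two stages of the same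
  process, hence comparable with the hitting graph.\<close>

lemma set_take_arrange:
  "\<exists>i. {x \<in> set xs. fst (f x)} = set (take i (arrange f xs))"
  "\<exists>j. {x \<in> set xs. fst (f x) \<or> snd (f x)} = set (take j (arrange f xs))"
proof -
  show "\<exists>i. {x \<in> set xs. fst (f x)} = set (take i (arrange f xs))"
    by (intro exI[of _ "length (filter (\<lambda>x. fst (f x)) xs)"]) (auto simp: arrange_def)
  show "\<exists>j. {x \<in> set xs. fst (f x) \<or> snd (f x)} = set (take j (arrange f xs))"
    by (intro exI[of _ "length (filter (\<lambda>x. fst (f x)) xs @ filter (\<lambda>x. \<not> fst (f x) \<and> snd (f x)) xs)"])
      (auto simp: arrange_def)
qed

text \<open>Permuting the elements by \<open>\<tau>\<close> commutes with \<open>arrange\<close> and preserves the law of its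
  two independent arguments, so the law of the arranged list is invariant under \<open>\<tau>\<close>.\<close>

lemma arrange_uniform:
  assumes "finite A"
  shows "map_pmf (\<lambda>(f, xs). arrange f xs)
      (pair_pmf (Pi_pmf A d (\<lambda>_. q)) (pmf_of_set (permutations_of_set A))) =
    pmf_of_set (permutations_of_set A)" (is "map_pmf ?a (pair_pmf ?F ?U) = ?U")
proof (rule pmf_of_set_permutations_eqI)
  have P: "finite (permutations_of_set A)" "permutations_of_set A \<noteq> {}"
    using assms by (auto simp: permutations_of_set_empty_iff)
  show "set_pmf (map_pmf ?a (pair_pmf ?F ?U)) \<subseteq> permutations_of_set A"
    using P by (auto intro: arrange_in_permutations)
  fix \<tau>
  assume \<tau>: "\<tau> permutes A"
  \<comment> \<open>After relabelling, the class of \<open>\<tau> x\<close> has to be that of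
    \<open>x\<close>, hence \<open>inv \<tau>\<close>.\<close>
  have "map \<tau> (arrange f xs) = arrange (f \<circ> inv \<tau>) (map \<tau> xs)" for f :: "'a \<Rightarrow> bool \<times> bool" and xs
    using permutes_inverses[OF \<tau>] by (simp add: arrange_def filter_map o_def)
  then have "map_pmf (map \<tau>) (map_pmf ?a (pair_pmf ?F ?U)) =
      map_pmf ?a (map_pmf (\<lambda>(f, xs). (f \<circ> inv \<tau>, map \<tau> xs)) (pair_pmf ?F ?U))"
    by (simp add: pmf.map_comp o_def case_prod_beta)
  also have "map_pmf (\<lambda>(f, xs). (f \<circ> inv \<tau>, map \<tau> xs)) (pair_pmf ?F ?U) =
      pair_pmf (map_pmf (\<lambda>f. f \<circ> inv \<tau>) ?F) (map_pmf (map \<tau>) ?U)"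
    by (rule map_pair)
  also have "map_pmf (\<lambda>f. f \<circ> inv \<tau>) ?F = ?F"
    using permutes_inv[OF \<tau>] assms
    by (intro Pi_pmf_bij_betw[symmetric]) (auto simp: permutes_imp_bij permutes_in_image)
  also have "map_pmf (map \<tau>) ?U = ?U"
  proof (subst map_pmf_of_set_bij_betw[of _ _ "permutations_of_set A"])
    have "map \<tau> ` permutations_of_set A = permutations_of_set A"
      using permutations_of_set_image_inj[of \<tau> A] permutes_image[OF \<tau>] permutes_inj[OF \<tau>]
      by (metis inj_on_subset subset_UNIV)
    then show "bij_betw (map \<tau>) (permutations_of_set A) (permutations_of_set A)"
      using permutes_inj[OF \<tau>] by (auto simp: bij_betw_def intro: inj_on_subset)
  qed (use P in auto)
  finally show "map_pmf (map \<tau>) (map_pmf ?a (pair_pmf ?F ?U)) = map_pmf ?a (pair_pmf ?F ?U)" .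
qed (fact assms)

text \<open>Colouring a random edge set afresh amounts to colouring all of \<open>K\<close>
  beforehand and restricting, which makes the colours independent of the ordering.\<close>

lemma random_colouring_restrict:
  assumes "finite K" "E \<subseteq> K"
  shows "pmf_of_set (PiE E (\<lambda>_. UNIV :: bool set)) =
    map_pmf (\<lambda>c x. if x \<in> E then c x else undefined) (Pi_pmf K undefined (\<lambda>_. bernoulli_pmf (1/2)))"
proof -
  \<comment> \<open>Extensional functions take the value \<open>undefined\<close> outside
    \<open>E\<close>, which is the default of the product.\<close>
  have "PiE E (\<lambda>_. UNIV :: bool set) = PiE_dflt E undefined (\<lambda>_. UNIV)"
    by (auto simp: PiE_dflt_def PiE_def extensional_def)
  then have "pmf_of_set (PiE E (\<lambda>_. UNIV :: bool set)) =
      Pi_pmf E undefined (\<lambda>_. pmf_of_set (UNIV :: bool set))"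
    using assms by (subst Pi_pmf_of_set) (auto intro: finite_subset)
  also have "\<dots> = map_pmf (\<lambda>c x. if x \<in> E then c x else undefined)
      (Pi_pmf K undefined (\<lambda>_. pmf_of_set UNIV))"
    using assms by (rule Pi_pmf_subset)
  finally show ?thesis
    by (simp only: bernoulli_pmf_half_conv_pmf_of_set)
qed

text \<open>A state is ((early, middle), colour); the middle flag only matters for edges that are not early.\<close>

definition edge_state :: "real \<Rightarrow> real \<Rightarrow> ((bool \<times> bool) \<times> bool) pmf" where
  "edge_state p q = pair_pmf (pair_pmf (bernoulli_pmf p) (bernoulli_pmf q)) (bernoulli_pmf (1/2))"

definition edge_model :: "nat \<Rightarrow> real \<Rightarrow> real \<Rightarrow> (nat set \<Rightarrow> (bool \<times> bool) \<times> bool) pmf" where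
  "edge_model n p q = Pi_pmf (Kn_edges n) ((False, False), undefined) (\<lambda>_. edge_state p q)"

definition early :: "nat \<Rightarrow> (nat set \<Rightarrow> (bool \<times> bool) \<times> bool) \<Rightarrow> nat set set" where
  "early n \<omega> = {e \<in> Kn_edges n. fst (fst (\<omega> e))}"

definition timely :: "nat \<Rightarrow> (nat set \<Rightarrow> (bool \<times> bool) \<times> bool) \<Rightarrow> nat set set" where
  "timely n \<omega> = {e \<in> Kn_edges n. fst (fst (\<omega> e)) \<or> snd (fst (\<omega> e))}"

lemma set_graph_process: "set_pmf (graph_process n) = permutations_of_set (Kn_edges n)"
  unfolding graph_process_def by (rule set_pmf_of_set) (auto simp: permutations_of_set_empty_iff)

text \<open>Holds for all \<open>p\<close> and \<open>q\<close>, because \<open>arrange\<close>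
  yields a uniform ordering whatever the law of the classes.\<close>

lemma coloured_hitting_graph_eq:
  "coloured_hitting_graph n = map_pmf
     (\<lambda>(\<omega>, xs). let es = arrange (fst \<circ> \<omega>) xs; E = set (take (tau1 n es) es)
        in (E, \<lambda>e. if e \<in> E then snd (\<omega> e) else undefined))
     (pair_pmf (edge_model n p q) (graph_process n))"
proof -
  let ?K = "Kn_edges n"
  let ?G = "\<lambda>es. set (take (tau1 n es) es)"
  let ?F = "Pi_pmf ?K (False, False) (\<lambda>_. pair_pmf (bernoulli_pmf p) (bernoulli_pmf q))"
  let ?C = "Pi_pmf ?K undefined (\<lambda>_. bernoulli_pmf (1/2))"
  let ?r = "\<lambda>E c x. if x \<in> E then c x else undefined :: bool"
  have sub: "?G es \<subseteq> ?K" if "es \<in> set_pmf (graph_process n)" for es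
  proof -
    have "es \<in> permutations_of_set ?K"
      using that by (simp add: set_graph_process)
    then show ?thesis
      using set_take_subset[of "tau1 n es" es] by (auto simp: permutations_of_set_def)
  qed
  have "coloured_hitting_graph n =
      bind_pmf (graph_process n) (\<lambda>es. map_pmf (\<lambda>c. (?G es, ?r (?G es) c)) ?C)"
    unfolding coloured_hitting_graph_def Let_def
    by (intro bind_pmf_cong refl) (simp add: random_colouring_restrict[OF finite_Kn_edges sub] pmf.map_comp o_def)
  also have "graph_process n = map_pmf (\<lambda>(f, xs). arrange f xs) (pair_pmf ?F (graph_process n))"
    unfolding graph_process_def by (rule arrange_uniform[symmetric]) simp
  \<comment> \<open>Independence allows the colours to be drawn before \<open>xs\<close> and grouped
    with the classes.\<close>
  also have "bind_pmf (map_pmf (\<lambda>(f, xs). arrange f xs) (pair_pmf ?F (graph_process n)))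
      (\<lambda>es. map_pmf (\<lambda>c. (?G es, ?r (?G es) c)) ?C) =
    map_pmf (\<lambda>((f, c), xs). let es = arrange f xs in (?G es, ?r (?G es) c))
      (pair_pmf (pair_pmf ?F ?C) (graph_process n))"
    unfolding pair_pmf_def map_pmf_def Let_def
    by (simp add: bind_assoc_pmf bind_return_pmf)
      (subst bind_commute_pmf[of "graph_process n"], simp)
  also have "\<dots> = map_pmf
     (\<lambda>(\<omega>, xs). let es = arrange (fst \<circ> \<omega>) xs in (?G es, ?r (?G es) (snd \<circ> \<omega>)))
     (pair_pmf (map_pmf (\<lambda>(f, g) x. (f x, g x)) (pair_pmf ?F ?C)) (graph_process n))"
    by (simp add: pair_map_pmf1 pmf.map_comp o_def case_prod_beta Let_def)
      (intro map_pmf_cong refl, auto)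
  also have "map_pmf (\<lambda>(f, g) x. (f x, g x)) (pair_pmf ?F ?C) = edge_model n p q"
    unfolding edge_model_def edge_state_def by (rule Pi_pmf_pair[symmetric]) simp
  finally show ?thesis
    by (simp only: Let_def o_def)
qed

lemma tau1_between:
  assumes "A = set (take i es)" "B = set (take j es)" "\<not> min_deg_ge1 n A" "min_deg_ge1 n B"
  shows "A \<subseteq> set (take (tau1 n es) es)" "set (take (tau1 n es) es) \<subseteq> B"
    "min_deg_ge1 n (set (take (tau1 n es) es))"
proof -
  show md: "min_deg_ge1 n (set (take (tau1 n es) es))"
    unfolding tau1_def using assms by (intro LeastI) auto
  have "tau1 n es \<le> j"
    unfolding tau1_def using assms by (intro Least_le) auto
  then show "set (take (tau1 n es) es) \<subseteq> B"
    unfolding assms(2) by (rule set_take_subset_set_take)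
  \<comment> \<open>A stage before \<open>i\<close> is a subgraph of \<open>A\<close> and would pass
    its minimum degree on to \<open>A\<close>.\<close>
  have "i \<le> tau1 n es"
  proof (rule ccontr)
    assume "\<not> i \<le> tau1 n es"
    then have "set (take (tau1 n es) es) \<subseteq> A"
      unfolding assms(1) by (intro set_take_subset_set_take) simp
    then show False
      using md assms(3) unfolding min_deg_ge1_def by blast
  qed
  then show "A \<subseteq> set (take (tau1 n es) es)"
    unfolding assms(1) by (rule set_take_subset_set_take)
qed

text \<open>Asking for all graphs in between eliminates the ordering: \<open>good\<close> is an
  event of the product space alone.\<close>

theorem prob_not_zebraic_le:
  assumes "\<And>\<omega>. good \<omega> \<Longrightarrow> \<not> min_deg_ge1 n (early n \<omega>) \<and> min_deg_ge1 n (timely n \<omega>)"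
    "\<And>\<omega> E. good \<omega> \<Longrightarrow> early n \<omega> \<subseteq> E \<Longrightarrow> E \<subseteq> timely n \<omega> \<Longrightarrow> min_deg_ge1 n E \<Longrightarrow>
      zebraic_connected n E (snd \<circ> \<omega>)"
  shows "measure_pmf.prob (coloured_hitting_graph n) {(E, c). \<not> zebraic_connected n E c}
    \<le> measure_pmf.prob (edge_model n p q) {\<omega>. \<not> good \<omega>}"
proof -
  let ?M = "pair_pmf (edge_model n p q) (graph_process n)"
  let ?h = "\<lambda>(\<omega>, xs). let es = arrange (fst \<circ> \<omega>) xs; E = set (take (tau1 n es) es)
        in (E, \<lambda>e. if e \<in> E then snd (\<omega> e) else undefined)"
  have conn: "case ?h (\<omega>, xs) of (E, c) \<Rightarrow> zebraic_connected n E c"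
    if "good \<omega>" "xs \<in> set_pmf (graph_process n)" for \<omega> xs
  proof -
    have xs: "set xs = Kn_edges n"
      using that(2) by (simp add: set_graph_process permutations_of_set_def)
    let ?es = "arrange (fst \<circ> \<omega>) xs"
    let ?E = "set (take (tau1 n ?es) ?es)"
    obtain i where i: "early n \<omega> = set (take i ?es)"
      using set_take_arrange(1)[of xs "fst \<circ> \<omega>"] by (auto simp: early_def xs)
    obtain j where j: "timely n \<omega> = set (take j ?es)"
      using set_take_arrange(2)[of xs "fst \<circ> \<omega>"] by (auto simp: timely_def xs)
    have "zebraic_connected n ?E (snd \<circ> \<omega>)"
      using tau1_between[OF i j] assms(1)[OF that(1)] by (intro assms(2)[OF that(1)]) auto
    then have "zebraic_connected n ?E (\<lambda>e. if e \<in> ?E then snd (\<omega> e) else undefined)"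
      by (subst zebraic_connected_cong[of _ _ "snd \<circ> \<omega>"]) auto
    then show ?thesis
      by (simp add: Let_def)
  qed
  have "measure_pmf.prob (coloured_hitting_graph n) {(E, c). \<not> zebraic_connected n E c} =
      measure_pmf.prob ?M (?h -` {(E, c). \<not> zebraic_connected n E c})"
    by (subst coloured_hitting_graph_eq[of n p q]) (rule measure_map_pmf)
  also have "\<dots> \<le> measure_pmf.prob ?M (fst -` {\<omega>. \<not> good \<omega>})"
  proof (intro measure_pmf.finite_measure_mono_AE AE_pmfI impI)
    fix z
    assume z: "z \<in> set_pmf ?M" "z \<in> ?h -` {(E, c). \<not> zebraic_connected n E c}"
    obtain \<omega> xs where "z = (\<omega>, xs)" by fastforce
    then show "z \<in> fst -` {\<omega>. \<not> good \<omega>}"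
      using conn[of \<omega> xs] z by auto
  qed simp
  also have "\<dots> = measure_pmf.prob (map_pmf fst ?M) {\<omega>. \<not> good \<omega>}"
    by (rule measure_map_pmf[symmetric])
  also have "map_pmf fst ?M = edge_model n p q"
    by (rule map_fst_pair_pmf)
  finally show ?thesis .
qed

section \<open>Probabilities in the independent model\<close>

lemma expectation_if:
  "measure_pmf.expectation M (\<lambda>s. if Q s then a else b) = b + measure_pmf.prob M {s. Q s} * (a - b :: real)"
proof -
  have "(\<lambda>s. if Q s then a else b) = (\<lambda>s. b + (a - b) * indicator {s. Q s} s)"
    by (auto simp: indicator_def)
  then show ?thesis
    by (simp add: integrable_indicator_iff[of "measure_pmf M"] measure_pmf.emeasure_eq_measure)
qed

lemma prob_UNIV_diff: "measure_pmf.prob M (UNIV - A) = 1 - measure_pmf.prob M A"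
  using measure_pmf.prob_compl[of A M] by simp

lemma prob_Ex_le:
  assumes "finite I" "real (card I) \<le> N" "0 \<le> B" "\<And>i. i \<in> I \<Longrightarrow> measure_pmf.prob M {\<omega>. P i \<omega>} \<le> B"
  shows "measure_pmf.prob M {\<omega>. \<exists>i\<in>I. P i \<omega>} \<le> N * B"
proof -
  have "{\<omega>. \<exists>i\<in>I. P i \<omega>} = (\<Union>i\<in>I. {\<omega>. P i \<omega>})" by auto
  then have "measure_pmf.prob M {\<omega>. \<exists>i\<in>I. P i \<omega>} \<le> (\<Sum>i\<in>I. measure_pmf.prob M {\<omega>. P i \<omega>})"
    using assms(1) by (simp add: measure_pmf.finite_measure_subadditive_finite)
  also have "\<dots> \<le> (\<Sum>i\<in>I. B)"
    using assms(4) by (rule sum_mono)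
  also have "\<dots> \<le> N * B"
    using assms(2,3) by (simp add: mult_right_mono)
  finally show ?thesis .
qed

lemma finite_set_edge_model [simp]: "finite (set_pmf (edge_model n p q))"
  unfolding edge_model_def by (rule finite_subset[OF set_Pi_pmf_subset']) auto

lemma integrable_edge_model [simp]: "integrable (measure_pmf (edge_model n p q)) (f :: _ \<Rightarrow> real)"
  by (rule integrable_measure_pmf_finite) simp

lemma expectation_edge_model_prod:
  fixes g :: "nat set \<Rightarrow> (bool \<times> bool) \<times> bool \<Rightarrow> real"
  assumes "I \<subseteq> Kn_edges n" "\<And>e s. 0 \<le> g e s"
  shows "measure_pmf.expectation (edge_model n p q) (\<lambda>\<omega>. \<Prod>e\<in>I. g e (\<omega> e)) =
    (\<Prod>e\<in>I. measure_pmf.expectation (edge_state p q) (g e))"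
proof -
  have split: "(\<Prod>e\<in>I. h e) = (\<Prod>e\<in>Kn_edges n. if e \<in> I then h e else 1)" for h :: "nat set \<Rightarrow> real"
    using assms(1) by (simp add: prod.If_cases Int_absorb1)
  have "measure_pmf.expectation (edge_model n p q) (\<lambda>\<omega>. \<Prod>e\<in>Kn_edges n. if e \<in> I then g e (\<omega> e) else 1) =
     (\<Prod>e\<in>Kn_edges n. measure_pmf.expectation (edge_state p q) (\<lambda>s. if e \<in> I then g e s else 1))"
    unfolding edge_model_def using assms(2)
    by (intro expectation_prod_Pi_pmf integrable_measure_pmf_finite) auto
  also have "\<dots> = (\<Prod>e\<in>Kn_edges n. if e \<in> I then measure_pmf.expectation (edge_state p q) (g e) else 1)"
    by (intro prod.cong) auto
  finally show ?thesis
    by (simp only: split)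
qed

text \<open>Markov's inequality in product form. Factors 0 and 1 bound product events, exponential
  factors give Chernoff bounds.\<close>

lemma edge_model_prob_le:
  fixes g :: "nat set \<Rightarrow> (bool \<times> bool) \<times> bool \<Rightarrow> real"
  assumes "I \<subseteq> Kn_edges n" "\<And>e s. 0 \<le> g e s" "0 \<le> B"
    "\<And>\<omega>. P \<omega> \<Longrightarrow> 1 \<le> B * (\<Prod>e\<in>I. g e (\<omega> e))"
  shows "measure_pmf.prob (edge_model n p q) {\<omega>. P \<omega>} \<le>
    B * (\<Prod>e\<in>I. measure_pmf.expectation (edge_state p q) (g e))"
proof -
  have "measure_pmf.prob (edge_model n p q) {\<omega>. P \<omega>} =
      measure_pmf.expectation (edge_model n p q) (indicator {\<omega>. P \<omega>})"
    by simp
  also have "\<dots> \<le> measure_pmf.expectation (edge_model n p q) (\<lambda>\<omega>. B * (\<Prod>e\<in>I. g e (\<omega> e)))"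
    using assms(2-) by (intro integral_mono) (simp_all add: indicator_def prod_nonneg)
  also have "\<dots> = B * (\<Prod>e\<in>I. measure_pmf.expectation (edge_state p q) (g e))"
    using expectation_edge_model_prod[OF assms(1), of g p q] assms(2) by simp
  finally show ?thesis .
qed

context
  fixes n :: nat and p q :: real
  assumes p: "0 \<le> p" "p \<le> 1" and q: "0 \<le> q" "q \<le> 1"
begin

lemma prob_early: "measure_pmf.prob (edge_state p q) {s. fst (fst s)} = p"
proof -
  have eq: "{s. fst (fst s)} = ({True} \<times> UNIV) \<times> (UNIV :: bool set)"
    by auto
  show ?thesis
    unfolding eq edge_state_def using p by (simp add: measure_pmf_prob_product measure_pmf_single)
qed

lemma prob_early_hue: "measure_pmf.prob (edge_state p q) {s. fst (fst s) \<and> snd s = a} = p / 2"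
proof -
  have eq: "{s. fst (fst s) \<and> snd s = a} = ({True} \<times> UNIV) \<times> {a}"
    by auto
  show ?thesis
    unfolding eq edge_state_def using p by (cases a) (simp_all add: measure_pmf_prob_product measure_pmf_single)
qed

lemma prob_not_timely:
  "measure_pmf.prob (edge_state p q) {s. \<not> (fst (fst s) \<or> snd (fst s))} = (1 - p) * (1 - q)"
proof -
  have eq: "{s. \<not> (fst (fst s) \<or> snd (fst s))} = ({False} \<times> {False}) \<times> (UNIV :: bool set)"
    by auto
  show ?thesis
    unfolding eq edge_state_def using p q by (simp add: measure_pmf_prob_product measure_pmf_single pmf_pair)
qed

lemma prob_timely_le: "measure_pmf.prob (edge_state p q) {s. fst (fst s) \<or> snd (fst s)} \<le> p + q"
proof -
  have eq: "{s. fst (fst s) \<or> snd (fst s)} = UNIV - {s. \<not> (fst (fst s) \<or> snd (fst s))}"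
    by auto
  have "measure_pmf.prob (edge_state p q) {s. fst (fst s) \<or> snd (fst s)} = 1 - (1 - p) * (1 - q)"
    unfolding eq prob_UNIV_diff prob_not_timely ..
  also have "\<dots> = p + q - p * q"
    by (simp add: algebra_simps)
  finally show ?thesis
    using p q by simp
qed

lemma card_star:
  assumes "x < n"
  shows "card ((\<lambda>w. {x, w}) ` ({..<n} - {x})) = n - 1" "(\<lambda>w. {x, w}) ` ({..<n} - {x}) \<subseteq> Kn_edges n"
proof -
  have "inj_on (\<lambda>w. {x, w}) ({..<n} - {x})"
    by (auto simp: inj_on_def doubleton_eq_iff)
  then show "card ((\<lambda>w. {x, w}) ` ({..<n} - {x})) = n - 1"
    using assms by (simp add: card_image)
  show "(\<lambda>w. {x, w}) ` ({..<n} - {x}) \<subseteq> Kn_edges n"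
    using assms by (auto simp: Kn_edges_iff)
qed

text \<open>Dropping the factor \<open>1 - p\<close> is affordable: \<open>q = 2 * ln n / n\<close>
  alone gives about 1/n.\<close>

lemma prob_timely_isolated_le:
  "measure_pmf.prob (edge_model n p q) {\<omega>. \<not> min_deg_ge1 n (timely n \<omega>)} \<le> n * exp (- q * (real n - 1))"
proof -
  let ?P = "\<lambda>x \<omega>. \<forall>e\<in>timely n \<omega>. x \<notin> e"
  let ?g = "\<lambda>(e :: nat set) s. if \<not> (fst (fst s) \<or> snd (fst s)) then 1 else 0 :: real"
  have "measure_pmf.prob (edge_model n p q) {\<omega>. ?P x \<omega>} \<le> exp (- q * (real n - 1))"
    if x: "x \<in> {..<n}" for x
  proof -
    let ?I = "(\<lambda>w. {x, w}) ` ({..<n} - {x})"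
    have I: "card ?I = n - 1" "?I \<subseteq> Kn_edges n"
      using card_star x by auto
    have "measure_pmf.prob (edge_model n p q) {\<omega>. ?P x \<omega>} \<le>
        1 * (\<Prod>e\<in>?I. measure_pmf.expectation (edge_state p q) (?g e))"
    proof (rule edge_model_prob_le[OF I(2), where g = ?g and B = 1])
      fix \<omega>
      assume iso: "?P x \<omega>"
      have "?g e (\<omega> e) = 1" if "e \<in> ?I" for e
      proof -
        have "e \<in> Kn_edges n" "x \<in> e"
          using that I(2) by auto
        then show ?thesis
          using iso by (auto simp: timely_def)
      qed
      then show "1 \<le> 1 * (\<Prod>e\<in>?I. ?g e (\<omega> e))"
        by (simp only: prod.neutral_const cong: prod.cong)
    qed auto
    also have "\<dots> = ((1 - p) * (1 - q)) ^ (n - 1)"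
      using I(1) by (simp only: expectation_if prob_not_timely prod_constant) simp
    also have "\<dots> \<le> exp (- q) ^ (n - 1)"
    proof (rule power_mono)
      have "(1 - p) * (1 - q) \<le> 1 * (1 - q)"
        using p q by (intro mult_right_mono) auto
      also have "\<dots> \<le> exp (- q)"
        using exp_ge_add_one_self[of "- q"] by simp
      finally show "(1 - p) * (1 - q) \<le> exp (- q)" .
    qed (use p q in simp)
    also have "\<dots> = exp (- q * (real n - 1))"
      using x by (simp add: exp_of_nat_mult[symmetric] of_nat_diff mult.commute)
    finally show ?thesis .
  qed
  then have "measure_pmf.prob (edge_model n p q) {\<omega>. \<exists>x\<in>{..<n}. ?P x \<omega>} \<le> n * exp (- q * (real n - 1))"
    by (intro prob_Ex_le) auto
  moreover have "{\<omega>. \<exists>x\<in>{..<n}. ?P x \<omega>} = {\<omega>. \<not> min_deg_ge1 n (timely n \<omega>)}"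
    by (auto simp: min_deg_ge1_def)
  ultimately show ?thesis by simp
qed

section \<open>Second moment of the number of isolated early vertices\<close>

lemma prob_no_early:
  assumes "I \<subseteq> Kn_edges n"
  shows "measure_pmf.prob (edge_model n p q) {\<omega>. \<forall>e\<in>I. \<not> fst (fst (\<omega> e))} = (1 - p) ^ card I"
proof -
  have fin: "finite I"
    using assms finite_Kn_edges finite_subset by blast
  have "measure_pmf.prob (edge_model n p q) {\<omega>. \<forall>e\<in>I. \<not> fst (fst (\<omega> e))} =
      measure_pmf.expectation (edge_model n p q) (indicator {\<omega>. \<forall>e\<in>I. \<not> fst (fst (\<omega> e))})"
    by simp
  also have "indicator {\<omega>. \<forall>e\<in>I. \<not> fst (fst (\<omega> e))} =
      (\<lambda>\<omega>. \<Prod>e\<in>I. if fst (fst (\<omega> e)) then 0 else 1 :: real)"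
    using fin by (auto simp: indicator_def fun_eq_iff)
  also have "measure_pmf.expectation (edge_model n p q) \<dots> =
      (\<Prod>e\<in>I. measure_pmf.expectation (edge_state p q) (\<lambda>s. if fst (fst s) then 0 else 1))"
    by (rule expectation_edge_model_prod[OF assms]) auto
  also have "\<dots> = (1 - p) ^ card I"
    by (simp only: expectation_if prob_early prod_constant) simp
  finally show ?thesis .
qed

text \<open>Chebyshev's inequality: positive minimum degree means that the number \<open>?X\<close>
  of isolated vertices is 0. Two stars share one edge, so the events are correlated by the factor 1
  / (1 - p), which leaves \<open>p / (1 - p)\<close>; the diagonal contributes one over the
  mean.\<close>

lemma prob_early_min_deg_le:
  assumes "p < 1" "2 \<le> n"
  shows "measure_pmf.prob (edge_model n p q) {\<omega>. min_deg_ge1 n (early n \<omega>)} \<le>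
    1 / (n * (1 - p) ^ (n - 1)) + p / (1 - p)"
proof -
  let ?M = "edge_model n p q"
  let ?I = "\<lambda>x. (\<lambda>w. {x, w}) ` ({..<n} - {x})"
  define A where "A x = {\<omega> :: nat set \<Rightarrow> (bool \<times> bool) \<times> bool. \<forall>e\<in>?I x. \<not> fst (fst (\<omega> e))}" for x
  let ?X = "\<lambda>\<omega>. \<Sum>x<n. indicator (A x) \<omega> :: real"
  define a where "a = (1 - p) ^ (n - 1)"
  define \<mu> where "\<mu> = n * a"
  have a: "0 < a"
    using assms by (simp add: a_def)
  have \<mu>: "0 < \<mu>"
    using a assms by (simp add: \<mu>_def)
  have one: "measure_pmf.prob ?M (A x) = a" if "x < n" for x
    using prob_no_early[of "?I x"] card_star[OF that] by (simp only: a_def A_def)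
  have two: "measure_pmf.prob ?M (A x \<inter> A y) = a\<^sup>2 / (1 - p)" if "x < n" "y < n" "x \<noteq> y" for x y
  proof -
    have "?I x \<inter> ?I y = {{x, y}}"
      using that by (auto simp: doubleton_eq_iff)
    then have "card (?I x) + card (?I y) = card (?I x \<union> ?I y) + 1"
      using card_Un_Int[of "?I x" "?I y"] by simp
    \<comment> \<open>The shared edge is counted once in the union; adding it back makes the power
      exactly \<open>a\<close> squared.\<close>
    then have c: "Suc (card (?I x \<union> ?I y)) = (n - 1) + (n - 1)"
      using card_star[OF that(1)] card_star[OF that(2)] by linarith
    have "A x \<inter> A y = {\<omega>. \<forall>e\<in>?I x \<union> ?I y. \<not> fst (fst (\<omega> e))}"
      unfolding A_def by blast
    then have "measure_pmf.prob ?M (A x \<inter> A y) = (1 - p) ^ card (?I x \<union> ?I y)"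
      using card_star(2)[OF that(1)] card_star(2)[OF that(2)]
      by (simp only:) (intro prob_no_early, auto)
    moreover have "(1 - p) * (1 - p) ^ card (?I x \<union> ?I y) = a\<^sup>2"
      unfolding a_def power_mult[symmetric] power_Suc[symmetric] c by (simp add: mult_2_right)
    ultimately show ?thesis
      using assms(1) by (simp add: field_simps)
  qed
  have EX: "measure_pmf.expectation ?M ?X = \<mu>"
    by (subst Bochner_Integration.integral_sum) (simp_all add: one \<mu>_def)
  have "measure_pmf.expectation ?M (\<lambda>\<omega>. (?X \<omega>)\<^sup>2) =
      measure_pmf.expectation ?M (\<lambda>\<omega>. \<Sum>x<n. \<Sum>y<n. indicator (A x \<inter> A y) \<omega>)"
    by (simp add: power2_eq_square sum_product indicator_inter_arith)
  also have "\<dots> = (\<Sum>x<n. \<Sum>y<n. measure_pmf.prob ?M (A x \<inter> A y))"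
    by (simp add: Bochner_Integration.integral_sum)
  \<comment> \<open>The diagonal receives the off-diagonal bound as well, so the sum is evaluated
    without splitting it.\<close>
  also have "\<dots> \<le> (\<Sum>x<n. \<Sum>y<n. a\<^sup>2 / (1 - p) + (if x = y then a else 0))"
  proof (intro sum_mono)
    fix x y
    assume "x \<in> {..<n}" "y \<in> {..<n}"
    then show "measure_pmf.prob ?M (A x \<inter> A y) \<le> a\<^sup>2 / (1 - p) + (if x = y then a else 0)"
      using one[of x] two[of x y] assms(1) by (cases "x = y") simp_all
  qed
  also have "\<dots> = \<mu>\<^sup>2 / (1 - p) + \<mu>"
    by (simp add: sum.distrib \<mu>_def power2_eq_square algebra_simps)
  finally have EX2: "measure_pmf.expectation ?M (\<lambda>\<omega>. (?X \<omega>)\<^sup>2) \<le> \<mu>\<^sup>2 / (1 - p) + \<mu>" .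
  have "measure_pmf.prob ?M {\<omega>. min_deg_ge1 n (early n \<omega>)} =
      measure_pmf.expectation ?M (indicator {\<omega>. min_deg_ge1 n (early n \<omega>)})"
    by simp
  also have "\<dots> \<le> measure_pmf.expectation ?M (\<lambda>\<omega>. (?X \<omega> - \<mu>)\<^sup>2 / \<mu>\<^sup>2)"
  proof (rule integral_mono)
    fix \<omega>
    have "?X \<omega> = 0" if md: "min_deg_ge1 n (early n \<omega>)"
    proof (rule sum.neutral, rule ballI)
      fix x
      assume "x \<in> {..<n}"
      then obtain e where e: "e \<in> Kn_edges n" "fst (fst (\<omega> e))" "x \<in> e"
        using md by (auto simp: min_deg_ge1_def early_def)
      then have "e \<in> ?I x"
        by (auto simp: Kn_edges_def)
      then show "indicator (A x) \<omega> = (0 :: real)"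
        using e by (auto simp: indicator_def A_def)
    qed
    then show "indicator {\<omega>. min_deg_ge1 n (early n \<omega>)} \<omega> \<le> (?X \<omega> - \<mu>)\<^sup>2 / \<mu>\<^sup>2"
      using \<mu> by (cases "min_deg_ge1 n (early n \<omega>)") simp_all
  qed simp_all
  also have "\<dots> = measure_pmf.expectation ?M (\<lambda>\<omega>. (?X \<omega>)\<^sup>2 - 2 * \<mu> * ?X \<omega> + \<mu>\<^sup>2) / \<mu>\<^sup>2"
    by (simp add: power2_diff algebra_simps)
  also have "\<dots> = (measure_pmf.expectation ?M (\<lambda>\<omega>. (?X \<omega>)\<^sup>2) - 2 * \<mu> * \<mu> + \<mu>\<^sup>2) / \<mu>\<^sup>2"
    by (simp only: Bochner_Integration.integral_add Bochner_Integration.integral_diff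
      Bochner_Integration.integral_mult_right integrable_edge_model EX) simp
  also have "\<dots> \<le> (\<mu>\<^sup>2 / (1 - p) + \<mu> - 2 * \<mu> * \<mu> + \<mu>\<^sup>2) / \<mu>\<^sup>2"
    using EX2 by (intro divide_right_mono) auto
  also have "\<dots> = 1 / \<mu> + p / (1 - p)"
    using \<mu> assms(1) by (simp add: field_simps power2_eq_square)
  finally show ?thesis
    by (simp add: \<mu>_def a_def)
qed

end

section \<open>Exponential bounds for the degrees of a few prescribed vertices\<close>

lemma prod_if_const:
  assumes "finite R"
  shows "(\<Prod>w\<in>R. if Q w then c else 1) = (c :: real) ^ card {w \<in> R. Q w}"
  using assms by (simp add: prod.inter_filter[symmetric])

text \<open>An edge of a star has one end outside \<open>Z\<close>, so it is not in
  \<open>H\<close>, and its end in \<open>Z\<close> determines the star.\<close>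

lemma prod_stars:
  fixes G :: "nat set \<Rightarrow> real"
  assumes "finite H" "finite L" "finite R" "L \<subseteq> Z" "R \<inter> Z = {}" "\<And>e. e \<in> H \<Longrightarrow> e \<subseteq> Z"
  shows "(\<Prod>e\<in>H \<union> (\<Union>z\<in>L. (\<lambda>w. {z, w}) ` R). G e) = (\<Prod>e\<in>H. G e) * (\<Prod>z\<in>L. \<Prod>w\<in>R. G {z, w})"
proof -
  have "(\<Prod>e\<in>H \<union> (\<Union>z\<in>L. (\<lambda>w. {z, w}) ` R). G e) = (\<Prod>e\<in>H. G e) * (\<Prod>e\<in>(\<Union>z\<in>L. (\<lambda>w. {z, w}) ` R). G e)"
    using assms by (intro prod.union_disjoint) auto
  also have "(\<Prod>e\<in>(\<Union>z\<in>L. (\<lambda>w. {z, w}) ` R). G e) = (\<Prod>z\<in>L. \<Prod>e\<in>(\<lambda>w. {z, w}) ` R. G e)"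
    using assms by (intro prod.UNION_disjoint) (auto simp: doubleton_eq_iff)
  also have "\<dots> = (\<Prod>z\<in>L. \<Prod>w\<in>R. G {z, w})"
    by (intro prod.cong refl prod.reindex_cong[where l = "\<lambda>w. {_, w}"]) (auto simp: inj_on_def doubleton_eq_iff)
  finally show ?thesis .
qed

text \<open>\<open>None\<close> accepts both colours, so one estimate treats low and poor vertices
  together.\<close>

definition seen :: "bool option \<Rightarrow> (bool \<times> bool) \<times> bool \<Rightarrow> bool" where
  "seen h s \<longleftrightarrow> fst (fst s) \<and> (case h of None \<Rightarrow> True | Some a \<Rightarrow> snd s = a)"

definition rate :: "bool option \<Rightarrow> real" where
  "rate h = (case h of None \<Rightarrow> 1 | Some a \<Rightarrow> 1 / 2)"

lemma prob_seen:
  assumes "0 \<le> p" "p \<le> 1" "0 \<le> q" "q \<le> 1"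
  shows "measure_pmf.prob (edge_state p q) {s. seen h s} = rate h * p"
  using prob_early[OF assms] prob_early_hue[OF assms] by (cases h) (auto simp: seen_def rate_def)

text \<open>Gives 1 - exp (- 3) at least 0.9: the factor 0.9 of the degree exponents, and half of it
  for one colour.\<close>

lemma exp_minus_3_le: "exp (- 3 :: real) \<le> 1 / 10"
proof -
  have "(10 :: real) \<le> (5 / 2) ^ 3"
    by (simp add: power3_eq_cube)
  also have "\<dots> \<le> exp 1 ^ 3"
  proof (rule power_mono)
    show "5 / 2 \<le> exp (1 :: real)"
      using exp_lower_Taylor_quadratic[of "1 :: real"] by simp
  qed simp
  also have "\<dots> = exp (3 :: real)"
    by (simp add: exp_of_nat_mult[symmetric])
  finally show ?thesis
    by (simp add: exp_minus field_simps)
qed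

text \<open>Exponential Markov inequality with weight \<open>exp (-3)\<close> per seen edge. Only edges leaving \<open>Z\<close>
  are counted, which makes the stars at the vertices of \<open>L\<close> and the edges in \<open>H\<close> disjoint.\<close>

lemma prob_stars_le:
  assumes pq: "0 \<le> p" "p \<le> 1" "0 \<le> q" "q \<le> 1"
    and Z: "Z \<subseteq> {..<n}" "card Z \<le> 4" "L \<subseteq> Z" "H \<subseteq> Kn_edges n" "\<And>e. e \<in> H \<Longrightarrow> e \<subseteq> Z"
    and t: "0 \<le> t"
  shows "measure_pmf.prob (edge_model n p q) {\<omega>. H \<subseteq> timely n \<omega> \<and>
      (\<forall>z\<in>L. real (card {w. w < n \<and> {z, w} \<in> Kn_edges n \<and> seen (h z) (\<omega> {z, w})}) \<le> t)} \<le>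
    (p + q) ^ card H * (\<Prod>z\<in>L. exp (3 * t - 0.9 * (rate (h z) * p) * (real n - 4)))"
proof -
  define R where "R = {..<n} - Z"
  have fin: "finite Z" "finite L" "finite R" "finite H"
    using Z by (auto simp: R_def intro: finite_subset[of _ "{..<n}"] finite_subset[of _ Z] finite_subset[OF _ finite_Kn_edges])
  let ?I = "H \<union> (\<Union>z\<in>L. (\<lambda>w. {z, w}) ` R)"
  \<comment> \<open>An edge leaving \<open>Z\<close> meets it in one vertex, so
    \<open>the_elem\<close> recovers its star and hence which colours count.\<close>
  define g where "g e s = (if e \<in> H then (if fst (fst s) \<or> snd (fst s) then 1 else 0)
    else if seen (h (the_elem (e \<inter> Z))) s then exp (- 3) else 1 :: real)" for e s
  have g_out: "g {z, w} = (\<lambda>s. if seen (h z) s then exp (- 3) else 1)" if "z \<in> L" "w \<in> R" for z w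
  proof -
    have "{z, w} \<notin> H"
      using that Z(5)[of "{z, w}"] by (auto simp: R_def)
    moreover have "{z, w} \<inter> Z = {z}"
      using that Z by (auto simp: R_def)
    ultimately show ?thesis
      by (simp add: g_def fun_eq_iff)
  qed
  have I: "?I \<subseteq> Kn_edges n"
    using Z(4) subsetD[OF Z(1)] subsetD[OF Z(3)] by (auto simp: R_def Kn_edges_iff)
  have split: "(\<Prod>e\<in>?I. G e) = (\<Prod>e\<in>H. G e) * (\<Prod>z\<in>L. \<Prod>w\<in>R. G {z, w})" for G :: "nat set \<Rightarrow> real"
    using fin Z by (intro prod_stars[where Z = Z]) (auto simp: R_def)
  let ?P = "\<lambda>\<omega>. H \<subseteq> timely n \<omega> \<and>
      (\<forall>z\<in>L. real (card {w. w < n \<and> {z, w} \<in> Kn_edges n \<and> seen (h z) (\<omega> {z, w})}) \<le> t)"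
  have "measure_pmf.prob (edge_model n p q) {\<omega>. ?P \<omega>} \<le>
      exp (3 * t) ^ card L * (\<Prod>e\<in>?I. measure_pmf.expectation (edge_state p q) (g e))"
  proof (rule edge_model_prob_le[OF I])
    fix \<omega>
    assume P: "?P \<omega>"
    have "g e (\<omega> e) = 1" if "e \<in> H" for e
      using P that by (auto simp: g_def timely_def)
    then have H1: "(\<Prod>e\<in>H. g e (\<omega> e)) = 1"
      by simp
    have star: "exp (- 3 * t) \<le> (\<Prod>w\<in>R. g {z, w} (\<omega> {z, w}))" if z: "z \<in> L" for z
    proof -
      let ?N = "{w \<in> R. seen (h z) (\<omega> {z, w})}"
      have "card ?N \<le> card {w. w < n \<and> {z, w} \<in> Kn_edges n \<and> seen (h z) (\<omega> {z, w})}"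
        using z Z by (intro card_mono) (auto simp: R_def Kn_edges_iff)
      then have "real (card ?N) \<le> t"
        using P z by fastforce
      then have "exp (- 3 * t) \<le> exp (- 3) ^ card ?N"
        by (simp add: exp_of_nat_mult[symmetric])
      also have "\<dots> = (\<Prod>w\<in>R. if seen (h z) (\<omega> {z, w}) then exp (- 3) else 1)"
        using fin by (simp add: prod_if_const)
      also have "\<dots> = (\<Prod>w\<in>R. g {z, w} (\<omega> {z, w}))"
        using z by (simp add: g_out)
      finally show ?thesis .
    qed
    have "1 = exp (3 * t) ^ card L * (\<Prod>z\<in>L. exp (- 3 * t))"
      by (simp add: exp_minus field_simps)
    also have "\<dots> \<le> exp (3 * t) ^ card L * (\<Prod>z\<in>L. \<Prod>w\<in>R. g {z, w} (\<omega> {z, w}))"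
      using star by (intro mult_left_mono prod_mono) auto
    finally show "1 \<le> exp (3 * t) ^ card L * (\<Prod>e\<in>?I. g e (\<omega> e))"
      by (simp add: split H1)
  qed (auto simp: g_def)
  also have "(\<Prod>e\<in>?I. measure_pmf.expectation (edge_state p q) (g e)) =
      (\<Prod>e\<in>H. measure_pmf.expectation (edge_state p q) (g e)) *
      (\<Prod>z\<in>L. \<Prod>w\<in>R. measure_pmf.expectation (edge_state p q) (g {z, w}))"
    by (rule split)
  also have "exp (3 * t) ^ card L * \<dots> \<le> exp (3 * t) ^ card L *
      ((p + q) ^ card H * (\<Prod>z\<in>L. exp (- 0.9 * (rate (h z) * p) * (real n - 4))))"
  proof (intro mult_left_mono mult_mono)
    have "measure_pmf.expectation (edge_state p q) (g e) \<le> p + q" if "e \<in> H" for e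
    proof -
      have "g e = (\<lambda>s. if fst (fst s) \<or> snd (fst s) then 1 else 0)"
        using that by (simp add: g_def fun_eq_iff)
      then show ?thesis
        using prob_timely_le[OF pq] by (simp only: expectation_if) simp
    qed
    then have "(\<Prod>e\<in>H. measure_pmf.expectation (edge_state p q) (g e)) \<le> (\<Prod>e\<in>H. p + q)"
      by (intro prod_mono) (auto simp: g_def intro!: Bochner_Integration.integral_nonneg)
    then show "(\<Prod>e\<in>H. measure_pmf.expectation (edge_state p q) (g e)) \<le> (p + q) ^ card H"
      by simp
    show "(\<Prod>z\<in>L. \<Prod>w\<in>R. measure_pmf.expectation (edge_state p q) (g {z, w})) \<le>
        (\<Prod>z\<in>L. exp (- 0.9 * (rate (h z) * p) * (real n - 4)))"
    proof (rule prod_mono)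
      fix z
      assume z: "z \<in> L"
      let ?r = "rate (h z) * p"
      have r: "0 \<le> ?r"
        using pq by (auto simp: rate_def split: option.splits)
      have "measure_pmf.expectation (edge_state p q) (g {z, w}) \<le> exp (- 0.9 * ?r)"
        if "w \<in> R" for w
      proof -
        have "measure_pmf.expectation (edge_state p q) (g {z, w}) = 1 + ?r * (exp (- 3) - 1)"
          by (simp only: g_out[OF z that] expectation_if prob_seen[OF pq])
        also have "\<dots> \<le> 1 + ?r * (- 0.9)"
          using r exp_minus_3_le by (intro add_left_mono mult_left_mono) auto
        also have "\<dots> \<le> exp (- 0.9 * ?r)"
          using exp_ge_add_one_self[of "- 0.9 * ?r"] by simp
        finally show ?thesis .
      qed
      then have "(\<Prod>w\<in>R. measure_pmf.expectation (edge_state p q) (g {z, w})) \<le> (\<Prod>w\<in>R. exp (- 0.9 * ?r))"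
        by (intro prod_mono) (auto simp: g_def intro!: Bochner_Integration.integral_nonneg)
      also have "\<dots> = exp (- 0.9 * ?r * card R)"
        by (simp add: exp_of_nat_mult[symmetric] mult.commute)
      also have "\<dots> \<le> exp (- 0.9 * ?r * (real n - 4))"
      proof -
        \<comment> \<open>Each star loses the at most four vertices of \<open>Z\<close>.\<close>
        have "real n - 4 \<le> card R"
          unfolding R_def using Z fin by (subst card_Diff_subset) auto
        then show ?thesis
          using r by (intro iffD2[OF exp_le_cancel_iff] mult_left_mono_neg) simp_all
      qed
      finally show "0 \<le> (\<Prod>w\<in>R. measure_pmf.expectation (edge_state p q) (g {z, w})) \<and>
          (\<Prod>w\<in>R. measure_pmf.expectation (edge_state p q) (g {z, w})) \<le> exp (- 0.9 * ?r * (real n - 4))"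
        by (auto simp: g_def intro!: prod_nonneg Bochner_Integration.integral_nonneg)
    qed
  qed (use pq in \<open>auto simp: g_def intro!: prod_nonneg Bochner_Integration.integral_nonneg\<close>)
  also have "\<dots> = (p + q) ^ card H * (\<Prod>z\<in>L. exp (3 * t - 0.9 * (rate (h z) * p) * (real n - 4)))"
  proof -
    have "exp (3 * t - 0.9 * (rate (h z) * p) * (real n - 4)) =
        exp (3 * t) * exp (- 0.9 * (rate (h z) * p) * (real n - 4))" for z
      by (simp add: exp_add[symmetric])
    then show ?thesis
      by (simp only: prod.distrib prod_constant mult_ac)
  qed
  finally show ?thesis .
qed

lemma nbrs_seen:
  "nbrs n (early n \<omega>) z = {w. w < n \<and> {z, w} \<in> Kn_edges n \<and> seen None (\<omega> {z, w})}"
  "nbrs n (hue (snd \<circ> \<omega>) (early n \<omega>) a) z = {w. w < n \<and> {z, w} \<in> Kn_edges n \<and> seen (Some a) (\<omega> {z, w})}"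
  by (auto simp: nbrs_def early_def hue_def seen_def)

text \<open>The scarce colour of a poor vertex is unknown; the union bound over all choices
  \<open>f\<close> costs a factor 2 per vertex of \<open>M\<close>.\<close>

lemma prob_low_poor_le:
  assumes pq: "0 \<le> p" "p \<le> 1" "0 \<le> q" "q \<le> 1"
    and Z: "Z \<subseteq> {..<n}" "card Z \<le> 4" "L \<subseteq> Z" "M \<subseteq> Z" "L \<inter> M = {}" "H \<subseteq> Kn_edges n" "\<And>e. e \<in> H \<Longrightarrow> e \<subseteq> Z"
    and t: "0 \<le> t"
  shows "measure_pmf.prob (edge_model n p q) {\<omega>. H \<subseteq> timely n \<omega> \<and>
      (\<forall>z\<in>L. low n (early n \<omega>) t z) \<and> (\<forall>z\<in>M. poor n (early n \<omega>) (snd \<circ> \<omega>) t z)} \<le>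
    (p + q) ^ card H * exp (3 * t - 0.9 * p * (real n - 4)) ^ card L *
      (2 * exp (3 * t - 0.45 * p * (real n - 4))) ^ card M"
proof -
  have fin: "finite Z" "finite L" "finite M"
    using Z by (auto intro: finite_subset[of _ "{..<n}"] finite_subset[of _ Z])
  let ?h = "\<lambda>f z. if z \<in> M then Some (f z) else None"
  let ?Q = "\<lambda>f \<omega>. H \<subseteq> timely n \<omega> \<and>
      (\<forall>z\<in>L \<union> M. real (card {w. w < n \<and> {z, w} \<in> Kn_edges n \<and> seen (?h f z) (\<omega> {z, w})}) \<le> t)"
  let ?l = "exp (3 * t - 0.9 * p * (real n - 4))"
  let ?b = "exp (3 * t - 0.45 * p * (real n - 4))"
  have "measure_pmf.prob (edge_model n p q) {\<omega>. ?Q f \<omega>} \<le> (p + q) ^ card H * (?l ^ card L * ?b ^ card M)" for f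
  proof -
    have "measure_pmf.prob (edge_model n p q) {\<omega>. ?Q f \<omega>} \<le>
        (p + q) ^ card H * (\<Prod>z\<in>L \<union> M. exp (3 * t - 0.9 * (rate (?h f z) * p) * (real n - 4)))"
      using Z t by (intro prob_stars_le[OF pq, where Z = Z]) auto
    also have "(\<Prod>z\<in>L \<union> M. exp (3 * t - 0.9 * (rate (?h f z) * p) * (real n - 4))) =
        (\<Prod>z\<in>L. exp (3 * t - 0.9 * (rate (?h f z) * p) * (real n - 4))) *
        (\<Prod>z\<in>M. exp (3 * t - 0.9 * (rate (?h f z) * p) * (real n - 4)))"
      using fin Z by (intro prod.union_disjoint) auto
    also have "(\<Prod>z\<in>L. exp (3 * t - 0.9 * (rate (?h f z) * p) * (real n - 4))) = (\<Prod>z\<in>L. ?l)"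
      using Z(5) by (intro prod.cong) (auto simp: rate_def)
    also have "(\<Prod>z\<in>M. exp (3 * t - 0.9 * (rate (?h f z) * p) * (real n - 4))) = (\<Prod>z\<in>M. ?b)"
      by (intro prod.cong) (auto simp: rate_def)
    finally show ?thesis by simp
  qed
  then have "measure_pmf.prob (edge_model n p q) {\<omega>. \<exists>f\<in>PiE M (\<lambda>_. UNIV). ?Q f \<omega>} \<le>
      2 ^ card M * ((p + q) ^ card H * (?l ^ card L * ?b ^ card M))"
    using fin pq by (intro prob_Ex_le) (auto simp: card_PiE intro: finite_PiE)
  moreover have "{\<omega>. H \<subseteq> timely n \<omega> \<and>
      (\<forall>z\<in>L. low n (early n \<omega>) t z) \<and> (\<forall>z\<in>M. poor n (early n \<omega>) (snd \<circ> \<omega>) t z)} \<subseteq>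
    {\<omega>. \<exists>f\<in>PiE M (\<lambda>_. UNIV). ?Q f \<omega>}"
  proof safe
    fix \<omega>
    assume H: "H \<subseteq> timely n \<omega>" and L: "\<forall>z\<in>L. low n (early n \<omega>) t z"
      and "\<forall>z\<in>M. poor n (early n \<omega>) (snd \<circ> \<omega>) t z"
    then obtain f where f: "\<And>z. z \<in> M \<Longrightarrow> low n (hue (snd \<circ> \<omega>) (early n \<omega>) (f z)) t z"
      unfolding poor_def by metis
    have "?Q (restrict f M) \<omega>"
      using H L f Z(5) by (auto simp: low_def nbrs_seen intro: less_imp_le)
    then show "\<exists>f\<in>PiE M (\<lambda>_. UNIV). ?Q f \<omega>"
      by (intro bexI[of _ "restrict f M"]) auto
  qed
  then have "measure_pmf.prob (edge_model n p q) {\<omega>. H \<subseteq> timely n \<omega> \<and>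
      (\<forall>z\<in>L. low n (early n \<omega>) t z) \<and> (\<forall>z\<in>M. poor n (early n \<omega>) (snd \<circ> \<omega>) t z)} \<le>
    measure_pmf.prob (edge_model n p q) {\<omega>. \<exists>f\<in>PiE M (\<lambda>_. UNIV). ?Q f \<omega>}"
    by (intro measure_pmf.finite_measure_mono) auto
  ultimately show ?thesis
    by (simp add: power_mult_distrib mult_ac)
qed

lemma prob_cover_le:
  assumes "finite I" "real (card I) \<le> N" "0 \<le> B" "\<And>i. i \<in> I \<Longrightarrow> measure_pmf.prob M {\<omega>. Q i \<omega>} \<le> B"
    "\<And>\<omega>. P \<omega> \<Longrightarrow> \<exists>i\<in>I. Q i \<omega>"
  shows "measure_pmf.prob M {\<omega>. P \<omega>} \<le> N * B"
proof -
  have "measure_pmf.prob M {\<omega>. P \<omega>} \<le> measure_pmf.prob M {\<omega>. \<exists>i\<in>I. Q i \<omega>}"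
    using assms(5) by (intro measure_pmf.finite_measure_mono) auto
  also have "\<dots> \<le> N * B"
    by (rule prob_Ex_le) (use assms in auto)
  finally show ?thesis .
qed

lemma timelyD: "{x, u} \<in> timely n \<omega> \<Longrightarrow> x < n \<and> u < n \<and> x \<noteq> u"
  by (auto simp: timely_def Kn_edges_iff)

lemma exp_le_one_plus: "1 + x * (exp y - 1) \<le> exp (x * exp y)" if "0 \<le> (x :: real)"
proof -
  have "1 + x * (exp y - 1) \<le> 1 + x * exp y"
    using that by (simp add: algebra_simps)
  also have "\<dots> \<le> exp (x * exp y)"
    using exp_ge_add_one_self[of "x * exp y"] by simp
  finally show ?thesis .
qed

section \<open>Union bounds over small configurations, sparse sets and joining edges\<close>

context
  fixes n :: nat and p q :: real
  assumes pq: "0 \<le> p" "p \<le> 1" "0 \<le> q" "q \<le> 1"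
begin

context
  fixes t :: real
  assumes t: "0 \<le> t"
begin

abbreviation (input) lows where "lows \<equiv> exp (3 * t - 0.9 * p * (real n - 4))"
abbreviation (input) poors where "poors \<equiv> 2 * exp (3 * t - 0.45 * p * (real n - 4))"

text \<open>For the final parameters the exponent of n is 2 - 1 - 0.78 - 0.375 = -0.155, up to
  logarithms.\<close>

lemma prob_low_poor_edge_le:
  "measure_pmf.prob (edge_model n p q) {\<omega>. \<exists>x u. {x, u} \<in> timely n \<omega> \<and>
      low n (early n \<omega>) t x \<and> poor n (early n \<omega>) (snd \<circ> \<omega>) t u} \<le>
    real n ^ 2 * ((p + q) * lows * poors)"
proof (rule prob_cover_le[where I = "{(x, u). x < n \<and> u < n \<and> x \<noteq> u}" and
      Q = "\<lambda>(x, u) \<omega>. {{x, u}} \<subseteq> timely n \<omega> \<and> (\<forall>z\<in>{x}. low n (early n \<omega>) t z) \<and>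
        (\<forall>z\<in>{u}. poor n (early n \<omega>) (snd \<circ> \<omega>) t z)"])
  have sub: "{(x, u). x < n \<and> u < n \<and> x \<noteq> u} \<subseteq> {..<n} \<times> {..<n}" by auto
  then show "finite {(x, u). x < n \<and> u < n \<and> x \<noteq> u}"
    by (rule finite_subset) simp
  have "card {(x, u). x < n \<and> u < n \<and> x \<noteq> u} \<le> n ^ 2"
    using card_mono[OF _ sub] by (simp add: power2_eq_square)
  then show "real (card {(x, u). x < n \<and> u < n \<and> x \<noteq> u}) \<le> real n ^ 2"
    by (simp flip: of_nat_power)
next
  fix i
  assume i: "i \<in> {(x, u). x < n \<and> u < n \<and> x \<noteq> u}"
  then obtain x u where xu: "i = (x, u)" "x < n" "u < n" "x \<noteq> u" by auto
  then show "measure_pmf.prob (edge_model n p q) {\<omega>. (case i of (x, u) \<Rightarrow> \<lambda>\<omega>. {{x, u}} \<subseteq> timely n \<omega> \<and>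
       (\<forall>z\<in>{x}. low n (early n \<omega>) t z) \<and> (\<forall>z\<in>{u}. poor n (early n \<omega>) (snd \<circ> \<omega>) t z)) \<omega>} \<le>
       (p + q) * lows * poors"
    using prob_low_poor_le[OF pq, of "{x, u}" n "{x}" "{u}" "{{x, u}}" t] t
    by (simp add: Kn_edges_iff)
qed (use pq in \<open>auto dest: timelyD\<close>)

text \<open>Here the exponent is 3 - 2 - 2 * 0.78 = -0.56.\<close>

lemma prob_low_low_le:
  "measure_pmf.prob (edge_model n p q) {\<omega>. \<exists>x y u. x \<noteq> y \<and> {x, u} \<in> timely n \<omega> \<and> {y, u} \<in> timely n \<omega> \<and>
      low n (early n \<omega>) t x \<and> low n (early n \<omega>) t y} \<le>
    real n ^ 3 * ((p + q) ^ 2 * lows ^ 2)"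
proof (rule prob_cover_le[where I = "{(x, y, u). x < n \<and> y < n \<and> u < n \<and> x \<noteq> y \<and> x \<noteq> u \<and> y \<noteq> u}" and
      Q = "\<lambda>(x, y, u) \<omega>. {{x, u}, {y, u}} \<subseteq> timely n \<omega> \<and> (\<forall>z\<in>{x, y}. low n (early n \<omega>) t z) \<and>
        (\<forall>z\<in>{}. poor n (early n \<omega>) (snd \<circ> \<omega>) t z)"])
  let ?I = "{(x, y, u). x < n \<and> y < n \<and> u < n \<and> x \<noteq> y \<and> x \<noteq> u \<and> y \<noteq> u}"
  have sub: "?I \<subseteq> {..<n} \<times> {..<n} \<times> {..<n}" by auto
  then show "finite ?I"
    by (rule finite_subset) simp
  have "card ?I \<le> n ^ 3"
    using card_mono[OF _ sub] by (simp add: power3_eq_cube card_cartesian_product mult.assoc)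
  then show "real (card ?I) \<le> real n ^ 3"
    by (simp flip: of_nat_power)
next
  let ?I = "{(x, y, u). x < n \<and> y < n \<and> u < n \<and> x \<noteq> y \<and> x \<noteq> u \<and> y \<noteq> u}"
  fix i
  assume i: "i \<in> ?I"
  then obtain x y u where xu: "i = (x, y, u)" "x < n" "y < n" "u < n" "x \<noteq> y" "x \<noteq> u" "y \<noteq> u" by auto
  have cards: "card {{x, u}, {y, u}} = 2" "card {x, y} = 2"
    using xu by (auto simp: doubleton_eq_iff card_insert_if)
  have "measure_pmf.prob (edge_model n p q) {\<omega>. {{x, u}, {y, u}} \<subseteq> timely n \<omega> \<and>
       (\<forall>z\<in>{x, y}. low n (early n \<omega>) t z) \<and> (\<forall>z\<in>{}. poor n (early n \<omega>) (snd \<circ> \<omega>) t z)} \<le>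
       (p + q) ^ card {{x, u}, {y, u}} * lows ^ card {x, y} * poors ^ card ({} :: nat set)"
    by (rule prob_low_poor_le[OF pq, where Z = "{x, y, u}"])
      (use xu t in \<open>auto simp: Kn_edges_iff card_insert_if\<close>)
  then show "measure_pmf.prob (edge_model n p q) {\<omega>. (case i of (x, y, u) \<Rightarrow> \<lambda>\<omega>. {{x, u}, {y, u}} \<subseteq> timely n \<omega> \<and>
       (\<forall>z\<in>{x, y}. low n (early n \<omega>) t z) \<and> (\<forall>z\<in>{}. poor n (early n \<omega>) (snd \<circ> \<omega>) t z)) \<omega>} \<le>
       (p + q) ^ 2 * lows ^ 2"
    by (simp only: cards xu(1) prod.case card.empty power_0 mult_1_right)
qed (use pq in \<open>auto dest: timelyD\<close>)

text \<open>The exponent is 4 - 3 - 3 * 0.375 = -0.125. For two poor neighbours it would be 3 - 2 -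
  0.75, which is positive; hence the number 2 in \<open>few_poor\<close>.\<close>

lemma prob_three_poor_le:
  "measure_pmf.prob (edge_model n p q) {\<omega>. \<exists>x. \<not> card {u \<in> nbrs n (timely n \<omega>) x.
      poor n (early n \<omega>) (snd \<circ> \<omega>) t u} \<le> 2} \<le>
    real n ^ 4 * ((p + q) ^ 3 * poors ^ 3)"
proof (rule prob_cover_le[where I = "{(x, u, v, w). x < n \<and> u < n \<and> v < n \<and> w < n \<and> distinct [x, u, v, w]}" and
      Q = "\<lambda>(x, u, v, w) \<omega>. {{x, u}, {x, v}, {x, w}} \<subseteq> timely n \<omega> \<and> (\<forall>z\<in>{}. low n (early n \<omega>) t z) \<and>
        (\<forall>z\<in>{u, v, w}. poor n (early n \<omega>) (snd \<circ> \<omega>) t z)"])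
  let ?I = "{(x, u, v, w). x < n \<and> u < n \<and> v < n \<and> w < n \<and> distinct [x, u, v, w]}"
  have sub: "?I \<subseteq> {..<n} \<times> {..<n} \<times> {..<n} \<times> {..<n}" by auto
  then show "finite ?I"
    by (rule finite_subset) simp
  have "card ?I \<le> n ^ 4"
    using card_mono[OF _ sub] by (simp add: power4_eq_xxxx card_cartesian_product mult.assoc)
  then show "real (card ?I) \<le> real n ^ 4"
    by (simp flip: of_nat_power)
next
  let ?I = "{(x, u, v, w). x < n \<and> u < n \<and> v < n \<and> w < n \<and> distinct [x, u, v, w]}"
  fix i
  assume i: "i \<in> ?I"
  then obtain x u v w where xu: "i = (x, u, v, w)" "x < n" "u < n" "v < n" "w < n" "distinct [x, u, v, w]" by auto
  have cards: "card {{x, u}, {x, v}, {x, w}} = 3" "card {u, v, w} = 3"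
    using xu by (auto simp: doubleton_eq_iff card_insert_if)
  have "measure_pmf.prob (edge_model n p q) {\<omega>. {{x, u}, {x, v}, {x, w}} \<subseteq> timely n \<omega> \<and>
       (\<forall>z\<in>{}. low n (early n \<omega>) t z) \<and> (\<forall>z\<in>{u, v, w}. poor n (early n \<omega>) (snd \<circ> \<omega>) t z)} \<le>
       (p + q) ^ card {{x, u}, {x, v}, {x, w}} * lows ^ card ({} :: nat set) * poors ^ card {u, v, w}"
    by (rule prob_low_poor_le[OF pq, where Z = "{x, u, v, w}"])
      (use xu t in \<open>auto simp: Kn_edges_iff card_insert_if\<close>)
  then show "measure_pmf.prob (edge_model n p q) {\<omega>. (case i of (x, u, v, w) \<Rightarrow> \<lambda>\<omega>.
       {{x, u}, {x, v}, {x, w}} \<subseteq> timely n \<omega> \<and>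
       (\<forall>z\<in>{}. low n (early n \<omega>) t z) \<and> (\<forall>z\<in>{u, v, w}. poor n (early n \<omega>) (snd \<circ> \<omega>) t z)) \<omega>} \<le>
       (p + q) ^ 3 * poors ^ 3"
    by (simp only: cards xu(1) prod.case card.empty power_0 mult_1_right)
next
  let ?I = "{(x, u, v, w). x < n \<and> u < n \<and> v < n \<and> w < n \<and> distinct [x, u, v, w]}"
  fix \<omega>
  assume "\<exists>x. \<not> card {u \<in> nbrs n (timely n \<omega>) x. poor n (early n \<omega>) (snd \<circ> \<omega>) t u} \<le> 2"
  then obtain x where "\<not> card {u \<in> nbrs n (timely n \<omega>) x. poor n (early n \<omega>) (snd \<circ> \<omega>) t u} \<le> 2"
    by blast
  then have "3 \<le> card {u \<in> nbrs n (timely n \<omega>) x. poor n (early n \<omega>) (snd \<circ> \<omega>) t u}"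
    by simp
  then obtain T where T: "T \<subseteq> {u \<in> nbrs n (timely n \<omega>) x. poor n (early n \<omega>) (snd \<circ> \<omega>) t u}" "card T = 3"
    by (rule obtain_subset_with_card_n)
  then obtain u v w where "T = {u, v, w}" "u \<noteq> v" "v \<noteq> w" "u \<noteq> w"
    by (auto simp: card_3_iff)
  then show "\<exists>i\<in>?I. (case i of (x, u, v, w) \<Rightarrow> \<lambda>\<omega>.
       {{x, u}, {x, v}, {x, w}} \<subseteq> timely n \<omega> \<and>
       (\<forall>z\<in>{}. low n (early n \<omega>) t z) \<and> (\<forall>z\<in>{u, v, w}. poor n (early n \<omega>) (snd \<circ> \<omega>) t z)) \<omega>"
    using T(1) by (intro bexI[of _ "(x, u, v, w)"]) (auto simp: nbrs_def dest: timelyD)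
qed (use pq in auto)

end

lemma card_edges_inside_le:
  assumes "U \<subseteq> {..<n}"
  shows "card {e \<in> Kn_edges n. e \<subseteq> U} \<le> card U ^ 2"
proof -
  have fin: "finite U"
    using assms finite_subset by blast
  have "{e \<in> Kn_edges n. e \<subseteq> U} \<subseteq> (\<lambda>(x, y). {x, y}) ` (U \<times> U)"
    by (auto simp: Kn_edges_def)
  then have "card {e \<in> Kn_edges n. e \<subseteq> U} \<le> card (U \<times> U)"
    using fin by (intro surj_card_le[where f = "\<lambda>(x, y). {x, y}"]) auto
  then show ?thesis
    using fin by (simp add: card_cartesian_product power2_eq_square)
qed

text \<open>Exponential Markov inequality with weight \<open>exp \<Lambda>\<close> per early edge,
  bounding the number of pairs in \<open>U\<close> crudely by \<open>card U ^ 2\<close>.\<close>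

lemma prob_dense_set_le:
  fixes r \<Lambda> :: real
  assumes "U \<subseteq> {..<n}" "0 \<le> \<Lambda>"
  shows "measure_pmf.prob (edge_model n p q) {\<omega>. r * card U \<le> card {e \<in> early n \<omega>. e \<subseteq> U}} \<le>
    exp (p * exp \<Lambda> * card U ^ 2 - r * \<Lambda> * card U)"
proof -
  let ?I = "{e \<in> Kn_edges n. e \<subseteq> U}"
  let ?g = "\<lambda>(e :: nat set) s. if fst (fst s) then exp \<Lambda> else 1 :: real"
  have "measure_pmf.prob (edge_model n p q) {\<omega>. r * card U \<le> card {e \<in> early n \<omega>. e \<subseteq> U}} \<le>
      exp (- r * \<Lambda> * card U) * (\<Prod>e\<in>?I. measure_pmf.expectation (edge_state p q) (?g e))"
  proof (rule edge_model_prob_le[where g = ?g])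
    fix \<omega>
    assume *: "r * card U \<le> card {e \<in> early n \<omega>. e \<subseteq> U}"
    have "{e \<in> early n \<omega>. e \<subseteq> U} = {e \<in> ?I. fst (fst (\<omega> e))}"
      by (auto simp: early_def)
    then have "(\<Prod>e\<in>?I. ?g e (\<omega> e)) = exp \<Lambda> ^ card {e \<in> early n \<omega>. e \<subseteq> U}"
      using prod_if_const[of ?I "\<lambda>e. fst (fst (\<omega> e))" "exp \<Lambda>"] by simp
    also have "\<dots> = exp (\<Lambda> * card {e \<in> early n \<omega>. e \<subseteq> U})"
      by (simp add: exp_of_nat_mult[symmetric] mult.commute)
    also have "\<dots> \<ge> exp (\<Lambda> * (r * card U))"
      using * assms(2) by (simp add: mult_left_mono)
    finally have "exp (- r * \<Lambda> * card U) * exp (\<Lambda> * (r * card U)) \<le> exp (- r * \<Lambda> * card U) * (\<Prod>e\<in>?I. ?g e (\<omega> e))"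
      by (intro mult_left_mono) auto
    then show "1 \<le> exp (- r * \<Lambda> * card U) * (\<Prod>e\<in>?I. ?g e (\<omega> e))"
      by (simp add: exp_add[symmetric] mult_ac)
  qed auto
  also have "(\<Prod>e\<in>?I. measure_pmf.expectation (edge_state p q) (?g e)) = (1 + p * (exp \<Lambda> - 1)) ^ card ?I"
    by (simp only: expectation_if prob_early[OF pq] prod_constant)
  also have "\<dots> \<le> exp (p * exp \<Lambda>) ^ card ?I"
    using pq assms(2) by (intro power_mono exp_le_one_plus) auto
  also have "\<dots> \<le> exp (p * exp \<Lambda>) ^ (card U ^ 2)"
    using pq card_edges_inside_le[OF assms(1)] by (intro power_increasing) auto
  also have "\<dots> = exp (p * exp \<Lambda> * card U ^ 2)"
    by (simp add: exp_of_nat_mult[symmetric] mult.commute)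
  also have "exp (- r * \<Lambda> * card U) * \<dots> = exp (p * exp \<Lambda> * card U ^ 2 - r * \<Lambda> * card U)"
    by (simp add: exp_add[symmetric])
  finally show ?thesis by simp
qed

text \<open>The size limit \<open>exp (- \<Lambda>) * n\<close> cancels the weight: p * exp
  \<Lambda> * u^2 is at most p * n * u. A fixed set of size u then fails with probability at most
  n^(-3u), against at most n^u such sets, and n sizes cost one more factor n.\<close>

lemma prob_dense_le:
  fixes r \<Lambda> :: real
  assumes "0 \<le> \<Lambda>" "1 \<le> n" "p * n + 3 * ln n \<le> r * \<Lambda>"
  shows "measure_pmf.prob (edge_model n p q) {\<omega>. \<exists>U. U \<subseteq> {..<n} \<and> U \<noteq> {} \<and> card U \<le> exp (- \<Lambda>) * n \<and>
      \<not> card {e \<in> early n \<omega>. e \<subseteq> U} < r * card U} \<le> real n * (1 / real n ^ 2)"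
proof (rule prob_cover_le[where I = "{1..n}" and Q = "\<lambda>u \<omega>. \<exists>U\<in>{U. U \<subseteq> {..<n} \<and> card U = u}.
    card U \<le> exp (- \<Lambda>) * n \<and> \<not> card {e \<in> early n \<omega>. e \<subseteq> U} < r * card U"])
  fix u
  assume "u \<in> {1..n}"
  then have u: "1 \<le> u" "u \<le> n" by auto
  have "measure_pmf.prob (edge_model n p q) {\<omega>. \<exists>U\<in>{U. U \<subseteq> {..<n} \<and> card U = u}.
      card U \<le> exp (- \<Lambda>) * n \<and> \<not> card {e \<in> early n \<omega>. e \<subseteq> U} < r * card U} \<le>
      real n ^ u * exp (- 3 * ln n * u)"
  proof (rule prob_Ex_le)
    have "card {U. U \<subseteq> {..<n} \<and> card U = u} \<le> n ^ u"
      using n_subsets[of "{..<n}" u] u binomial_le_pow by simp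
    then show "real (card {U. U \<subseteq> {..<n} \<and> card U = u}) \<le> real n ^ u"
      by (simp flip: of_nat_power)
    fix U
    assume "U \<in> {U. U \<subseteq> {..<n} \<and> card U = u}"
    then have U: "U \<subseteq> {..<n}" "card U = u" by auto
    show "measure_pmf.prob (edge_model n p q) {\<omega>. card U \<le> exp (- \<Lambda>) * n \<and>
        \<not> card {e \<in> early n \<omega>. e \<subseteq> U} < r * card U} \<le> exp (- 3 * ln n * u)"
    proof (cases "card U \<le> exp (- \<Lambda>) * n")
      case True
      then have "exp \<Lambda> * u \<le> exp \<Lambda> * (exp (- \<Lambda>) * n)"
        using U by (intro mult_left_mono) auto
      also have "\<dots> = n"
        by (simp add: exp_minus)
      finally have "p * u * (exp \<Lambda> * u) \<le> p * u * n"
        using pq by (intro mult_left_mono) auto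
      moreover have "u * (p * n + 3 * ln n) \<le> u * (r * \<Lambda>)"
        using assms(3) by (intro mult_left_mono) auto
      ultimately have "p * exp \<Lambda> * u ^ 2 - r * \<Lambda> * u \<le> - 3 * ln n * u"
        by (simp add: power2_eq_square algebra_simps)
      moreover have "measure_pmf.prob (edge_model n p q) {\<omega>. card U \<le> exp (- \<Lambda>) * n \<and>
          \<not> card {e \<in> early n \<omega>. e \<subseteq> U} < r * card U} \<le> exp (p * exp \<Lambda> * u ^ 2 - r * \<Lambda> * u)"
        using prob_dense_set_le[OF U(1) assms(1), of r] True U(2) by (simp add: not_less)
      ultimately show ?thesis
        by (meson exp_le_cancel_iff order_trans)
    qed simp
  qed auto
  also have "\<dots> = 1 / (real n ^ 2) ^ u"
  proof -
    have "exp (- 3 * ln n * u) = 1 / exp (ln n) ^ (3 * u)"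
      unfolding exp_of_nat_mult[symmetric] by (simp add: exp_minus field_simps)
    then have "exp (- 3 * ln n * u) = 1 / (real n ^ u * (real n ^ 2) ^ u)"
      using assms(2) by (simp flip: power_mult power_add)
    then show ?thesis
      using assms(2) by simp
  qed
  also have "\<dots> \<le> 1 / (real n ^ 2) ^ 1"
    using u assms(2) by (intro divide_left_mono power_increasing) auto
  finally show "measure_pmf.prob (edge_model n p q) {\<omega>. \<exists>U\<in>{U. U \<subseteq> {..<n} \<and> card U = u}.
      card U \<le> exp (- \<Lambda>) * n \<and> \<not> card {e \<in> early n \<omega>. e \<subseteq> U} < r * card U} \<le> 1 / real n ^ 2"
    by simp
next
  fix \<omega>
  assume "\<exists>U. U \<subseteq> {..<n} \<and> U \<noteq> {} \<and> card U \<le> exp (- \<Lambda>) * n \<and> \<not> card {e \<in> early n \<omega>. e \<subseteq> U} < r * card U"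
  then obtain U where U: "U \<subseteq> {..<n}" "U \<noteq> {}" "card U \<le> exp (- \<Lambda>) * n"
      "\<not> card {e \<in> early n \<omega>. e \<subseteq> U} < r * card U" by blast
  have "card U \<in> {1..n}"
    using U(1,2) card_mono[OF _ U(1)] finite_subset[OF U(1)] by (auto simp: Suc_le_eq card_gt_0_iff)
  then show "\<exists>u\<in>{1..n}. \<exists>U\<in>{U. U \<subseteq> {..<n} \<and> card U = u}.
      card U \<le> exp (- \<Lambda>) * n \<and> \<not> card {e \<in> early n \<omega>. e \<subseteq> U} < r * card U"
    using U by blast
qed auto

text \<open>For fixed \<open>h > 0\<close> and p of order ln n / n the exponent is of order n ln n,
  which beats the \<open>2 * 4 ^ n\<close> choices of colour and sets.\<close>

lemma prob_no_join_le:
  fixes h :: real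
  assumes "0 \<le> h"
  shows "measure_pmf.prob (edge_model n p q) {\<omega>. \<exists>a A B. A \<subseteq> {..<n} \<and> B \<subseteq> {..<n} \<and> A \<inter> B = {} \<and>
      h * n \<le> card A \<and> h * n \<le> card B \<and> \<not> (\<exists>u\<in>A. \<exists>v\<in>B. {u, v} \<in> hue (snd \<circ> \<omega>) (early n \<omega>) a)} \<le>
    2 * 4 ^ n * exp (- (p / 2) * (h * n) ^ 2)"
proof (rule prob_cover_le[where I = "UNIV \<times> {(A, B) \<in> Pow {..<n} \<times> Pow {..<n}. A \<inter> B = {} \<and> h * n \<le> card A \<and> h * n \<le> card B}"
      and Q = "\<lambda>(a, A, B) \<omega>. \<not> (\<exists>u\<in>A. \<exists>v\<in>B. {u, v} \<in> hue (snd \<circ> \<omega>) (early n \<omega>) a)"])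
  let ?J = "{(A, B) \<in> Pow {..<n} \<times> Pow {..<n}. A \<inter> B = {} \<and> h * n \<le> card A \<and> h * n \<le> card B}"
  have sub: "?J \<subseteq> Pow {..<n} \<times> Pow {..<n}" by auto
  then have "finite ?J"
    by (rule finite_subset) simp
  then show "finite ((UNIV :: bool set) \<times> ?J)"
    by simp
  have "card ?J \<le> 4 ^ n"
    using card_mono[OF _ sub] by (simp add: card_cartesian_product card_Pow power_mult_distrib[symmetric])
  then have "card ((UNIV :: bool set) \<times> ?J) \<le> 2 * 4 ^ n"
    by (simp add: card_cartesian_product)
  then show "real (card ((UNIV :: bool set) \<times> ?J)) \<le> 2 * 4 ^ n"
    using of_nat_mono by fastforce
  fix i
  assume "i \<in> (UNIV :: bool set) \<times> ?J"
  then obtain a A B where i: "i = (a, A, B)" and AB: "A \<subseteq> {..<n}" "B \<subseteq> {..<n}" "A \<inter> B = {}" "h * n \<le> card A" "h * n \<le> card B"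
    by auto
  let ?I = "(\<lambda>(u, v). {u, v}) ` (A \<times> B)"
  let ?g = "\<lambda>(e :: nat set) s. if fst (fst s) \<and> snd s = a then 0 else 1 :: real"
  have "inj_on (\<lambda>(u, v). {u, v}) (A \<times> B)"
    using AB(3) by (auto simp: inj_on_def doubleton_eq_iff)
  then have card_I: "card ?I = card A * card B"
    by (simp add: card_image card_cartesian_product)
  have I: "?I \<subseteq> Kn_edges n"
    using AB by (auto simp: Kn_edges_iff)
  have "measure_pmf.prob (edge_model n p q) {\<omega>. \<not> (\<exists>u\<in>A. \<exists>v\<in>B. {u, v} \<in> hue (snd \<circ> \<omega>) (early n \<omega>) a)} \<le>
      1 * (\<Prod>e\<in>?I. measure_pmf.expectation (edge_state p q) (?g e))"
  proof (rule edge_model_prob_le[OF I, where g = ?g and B = 1])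
    fix \<omega>
    assume none: "\<not> (\<exists>u\<in>A. \<exists>v\<in>B. {u, v} \<in> hue (snd \<circ> \<omega>) (early n \<omega>) a)"
    have "?g e (\<omega> e) = 1" if e: "e \<in> ?I" for e
    proof -
      obtain u v where "e = {u, v}" "u \<in> A" "v \<in> B"
        using e by auto
      then have "e \<in> Kn_edges n" "e \<notin> hue (snd \<circ> \<omega>) (early n \<omega>) a"
        using I none by auto
      then show ?thesis
        by (auto simp: hue_def early_def)
    qed
    then show "1 \<le> 1 * (\<Prod>e\<in>?I. ?g e (\<omega> e))"
      by (simp only: prod.neutral_const cong: prod.cong)
  qed auto
  also have "\<dots> = (1 - p / 2) ^ (card A * card B)"
    by (simp only: expectation_if prob_early_hue[OF pq] prod_constant card_I) simp
  also have "\<dots> \<le> exp (- (p / 2)) ^ (card A * card B)"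
    using exp_ge_add_one_self[of "- (p / 2)"] pq by (intro power_mono) auto
  also have "\<dots> = exp (- (p / 2) * (card A * card B))"
    by (simp add: exp_of_nat_mult[symmetric] mult.commute)
  also have "\<dots> \<le> exp (- (p / 2) * (h * n) ^ 2)"
  proof -
    have "(h * n) * (h * n) \<le> real (card A) * card B"
      using AB assms by (intro mult_mono) auto
    then show ?thesis
      using pq by (simp add: power2_eq_square mult_left_mono)
  qed
  finally show "measure_pmf.prob (edge_model n p q) {\<omega>. (case i of (a, A, B) \<Rightarrow> \<lambda>\<omega>.
      \<not> (\<exists>u\<in>A. \<exists>v\<in>B. {u, v} \<in> hue (snd \<circ> \<omega>) (early n \<omega>) a)) \<omega>} \<le> exp (- (p / 2) * (h * n) ^ 2)"
    by (simp only: i prod.case)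
next
  fix \<omega>
  let ?J = "{(A, B) \<in> Pow {..<n} \<times> Pow {..<n}. A \<inter> B = {} \<and> h * n \<le> card A \<and> h * n \<le> card B}"
  assume "\<exists>a A B. A \<subseteq> {..<n} \<and> B \<subseteq> {..<n} \<and> A \<inter> B = {} \<and>
      h * n \<le> card A \<and> h * n \<le> card B \<and> \<not> (\<exists>u\<in>A. \<exists>v\<in>B. {u, v} \<in> hue (snd \<circ> \<omega>) (early n \<omega>) a)"
  then obtain a A B where "(a, A, B) \<in> UNIV \<times> ?J" "\<not> (\<exists>u\<in>A. \<exists>v\<in>B. {u, v} \<in> hue (snd \<circ> \<omega>) (early n \<omega>) a)"
    by blast
  then show "\<exists>i\<in>UNIV \<times> ?J. (case i of (a, A, B) \<Rightarrow> \<lambda>\<omega>. \<not> (\<exists>u\<in>A. \<exists>v\<in>B. {u, v} \<in> hue (snd \<circ> \<omega>) (early n \<omega>) a)) \<omega>"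
    by (intro bexI[of _ "(a, A, B)"]) simp_all
qed simp

end

section \<open>Asymptotics\<close>

text \<open>Each conjunct negates a failure event in the form bounded above, so
  \<open>de_Morgan_conj\<close> turns the complement into a disjunction of exactly these
  events.\<close>

definition tame :: "nat \<Rightarrow> real \<Rightarrow> real \<Rightarrow> real \<Rightarrow> (nat set \<Rightarrow> (bool \<times> bool) \<times> bool) \<Rightarrow> bool" where
  "tame n t r eps \<omega> \<longleftrightarrow>
     \<not> (min_deg_ge1 n (early n \<omega>)) \<and>
     \<not> (\<not> min_deg_ge1 n (timely n \<omega>)) \<and>
     \<not> (\<exists>x u. {x, u} \<in> timely n \<omega> \<and> low n (early n \<omega>) t x \<and> poor n (early n \<omega>) (snd \<circ> \<omega>) t u) \<and>
     \<not> (\<exists>x y u. x \<noteq> y \<and> {x, u} \<in> timely n \<omega> \<and> {y, u} \<in> timely n \<omega> \<and>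
          low n (early n \<omega>) t x \<and> low n (early n \<omega>) t y) \<and>
     \<not> (\<exists>x. \<not> card {u \<in> nbrs n (timely n \<omega>) x. poor n (early n \<omega>) (snd \<circ> \<omega>) t u} \<le> 2) \<and>
     \<not> (\<exists>U. U \<subseteq> {..<n} \<and> U \<noteq> {} \<and> real (card U) \<le> eps * n \<and>
          \<not> real (card {e \<in> early n \<omega>. e \<subseteq> U}) < r * card U) \<and>
     \<not> (\<exists>a A B. A \<subseteq> {..<n} \<and> B \<subseteq> {..<n} \<and> A \<inter> B = {} \<and> eps / 8 * n \<le> card A \<and> eps / 8 * n \<le> card B \<and>
          \<not> (\<exists>u\<in>A. \<exists>v\<in>B. {u, v} \<in> hue (snd \<circ> \<omega>) (early n \<omega>) a))"

lemma tame_spread_graph: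
  assumes "tame n t r eps \<omega>" "early n \<omega> \<subseteq> E" "E \<subseteq> timely n \<omega>" "min_deg_ge1 n E"
    "16 * r \<le> t - 2" "4 < t" "0 < eps" "eps \<le> 1 / 4" "16 \<le> eps * n"
  shows "spread_graph n (early n \<omega>) E (snd \<circ> \<omega>) t r eps"
proof
  have low_poor: "\<not> (\<exists>x u. {x, u} \<in> timely n \<omega> \<and> low n (early n \<omega>) t x \<and> poor n (early n \<omega>) (snd \<circ> \<omega>) t u)"
    and low_low: "\<not> (\<exists>x y u. x \<noteq> y \<and> {x, u} \<in> timely n \<omega> \<and> {y, u} \<in> timely n \<omega> \<and>
          low n (early n \<omega>) t x \<and> low n (early n \<omega>) t y)"
    and few_poor: "\<not> (\<exists>x. \<not> card {u \<in> nbrs n (timely n \<omega>) x. poor n (early n \<omega>) (snd \<circ> \<omega>) t u} \<le> 2)"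
    and sparse: "\<not> (\<exists>U. U \<subseteq> {..<n} \<and> U \<noteq> {} \<and> real (card U) \<le> eps * n \<and>
          \<not> real (card {e \<in> early n \<omega>. e \<subseteq> U}) < r * card U)"
    and join: "\<not> (\<exists>a A B. A \<subseteq> {..<n} \<and> B \<subseteq> {..<n} \<and> A \<inter> B = {} \<and> eps / 8 * n \<le> card A \<and>
          eps / 8 * n \<le> card B \<and> \<not> (\<exists>u\<in>A. \<exists>v\<in>B. {u, v} \<in> hue (snd \<circ> \<omega>) (early n \<omega>) a))"
    using assms(1) unfolding tame_def by - (elim conjE, assumption)+
  show "E \<subseteq> Kn_edges n"
    using assms(3) by (auto simp: timely_def)
  show "\<not> poor n (early n \<omega>) (snd \<circ> \<omega>) t u" if "{x, u} \<in> E" "low n (early n \<omega>) t x" for x u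
    using low_poor assms(3) that by blast
  show False if "x \<noteq> y" "low n (early n \<omega>) t x" "low n (early n \<omega>) t y" "{x, u} \<in> E" "{y, u} \<in> E" for x y u
    using low_low subsetD[OF assms(3)] that by metis
  show "card {u \<in> nbrs n E x. poor n (early n \<omega>) (snd \<circ> \<omega>) t u} \<le> 2" for x
  proof -
    have "card {u \<in> nbrs n E x. poor n (early n \<omega>) (snd \<circ> \<omega>) t u} \<le>
        card {u \<in> nbrs n (timely n \<omega>) x. poor n (early n \<omega>) (snd \<circ> \<omega>) t u}"
      using assms(3) by (intro card_mono) (auto simp: nbrs_def)
    also have "\<dots> \<le> 2"
      using few_poor by blast
    finally show ?thesis .
  qed
  show "real (card {e \<in> early n \<omega>. e \<subseteq> U}) < r * card U"
    if "U \<subseteq> {..<n}" "U \<noteq> {}" "card U \<le> eps * n" for U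
    using sparse that by blast
  show "\<exists>u\<in>A. \<exists>v\<in>B. {u, v} \<in> hue (snd \<circ> \<omega>) (early n \<omega>) a"
    if "A \<subseteq> {..<n}" "B \<subseteq> {..<n}" "A \<inter> B = {}" "eps / 8 * n \<le> card A" "eps / 8 * n \<le> card B" for a A B
    using join that by blast
qed (use assms in auto)

lemma prob_Or_le:
  assumes "measure_pmf.prob M {\<omega>. P \<omega>} \<le> a" "measure_pmf.prob M {\<omega>. Q \<omega>} \<le> b"
  shows "measure_pmf.prob M {\<omega>. P \<omega> \<or> Q \<omega>} \<le> a + b"
proof -
  have "{\<omega>. P \<omega> \<or> Q \<omega>} = {\<omega>. P \<omega>} \<union> {\<omega>. Q \<omega>}" by auto
  then show ?thesis
    using measure_Un_le[of "{\<omega>. P \<omega>}" M "{\<omega>. Q \<omega>}"] assms by simp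
qed

text \<open>One summand for each way to fail \<open>tame\<close>, in the order of that definition.\<close>

definition defect :: "nat \<Rightarrow> real" where
  "defect n =
    (1 / (real n * (1 - 0.9 * ln n / n) powr (real n - 1)) + (0.9 * ln n / n) / (1 - 0.9 * ln n / n)) +
    (real n * exp (- (2 * ln n / n) * (real n - 1)) +
    (real n ^ 2 * ((0.9 * ln n / n + 2 * ln n / n) *
      exp (3 * (ln n / 100) - 0.9 * (0.9 * ln n / n) * (real n - 4)) *
      (2 * exp (3 * (ln n / 100) - 0.45 * (0.9 * ln n / n) * (real n - 4)))) +
    (real n ^ 3 * ((0.9 * ln n / n + 2 * ln n / n) ^ 2 *
      exp (3 * (ln n / 100) - 0.9 * (0.9 * ln n / n) * (real n - 4)) ^ 2) +
    (real n ^ 4 * ((0.9 * ln n / n + 2 * ln n / n) ^ 3 *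
      (2 * exp (3 * (ln n / 100) - 0.45 * (0.9 * ln n / n) * (real n - 4))) ^ 3) +
    (real n * (1 / real n ^ 2) +
    2 * 4 ^ n * exp (- (0.9 * ln n / n / 2) * (exp (- 8000) / 8 * real n) ^ 2))))))"

text \<open>Up to logarithms the summands have the orders n^(-0.1), n^(-1), n^(-0.155), n^(-0.56),
  n^(-0.125) and n^(-1); the last one decays faster than exponentially.\<close>

lemma defect_tendsto_0: "defect \<longlonglongrightarrow> 0"
proof -
  \<comment> \<open>Only positivity of this constant matters for the limit.\<close>
  define h :: real where "h = exp (- 8000) / 8"
  have h: "0 < h" by (simp add: h_def)
  have join: "(\<lambda>n. 2 * 4 ^ n * exp (- (0.9 * ln n / n / 2) * (h * real n) ^ 2)) \<longlonglongrightarrow> 0"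
    using h by real_asymp
  show ?thesis
    unfolding defect_def h_def[symmetric]
    by (intro tendsto_add_zero join; real_asymp)
qed

lemma prob_not_tame_le:
  fixes n :: nat
  defines "p \<equiv> 0.9 * ln n / n" and "q \<equiv> 2 * ln n / n"
  assumes "2 \<le> n" "p < 1" "q \<le> 1"
  shows "measure_pmf.prob (edge_model n p q) {\<omega>. \<not> tame n (ln n / 100) (ln n / 2000) (exp (- 8000)) \<omega>} \<le> defect n"
proof -
  have pq: "0 \<le> p" "p \<le> 1" "0 \<le> q" "q \<le> 1"
    using assms by (auto simp: p_def q_def)
  have t: "0 \<le> ln n / 100"
    using assms by simp
  have pow: "(1 - p) ^ (n - 1) = (1 - p) powr (real n - 1)"
    using assms by (simp add: powr_realpow[symmetric] of_nat_diff)
  \<comment> \<open>This reads 3.9 ln n \<le> 4 ln n and fixes \<open>\<Lambda>\<close> =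
    8000.\<close>
  have dense: "p * n + 3 * ln n \<le> (ln n / 2000) * 8000"
    using assms by (simp add: p_def)
  have isolated: "measure_pmf.prob (edge_model n p q) {\<omega>. min_deg_ge1 n (early n \<omega>)} \<le>
      1 / (real n * (1 - p) powr (real n - 1)) + p / (1 - p)"
    using prob_early_min_deg_le[OF pq assms(4,3)] by (simp only: pow)
  show ?thesis
    unfolding tame_def de_Morgan_conj not_not defect_def p_def[symmetric] q_def[symmetric]
    using assms(3)
    by (intro prob_Or_le isolated prob_timely_isolated_le[OF pq] prob_low_poor_edge_le[OF pq t]
      prob_low_low_le[OF pq t] prob_three_poor_le[OF pq t] prob_dense_le[OF pq _ _ dense]
      prob_no_join_le[OF pq]) simp_all
qed

theorem theorem4:
  shows "(\<lambda>n. measure_pmf.prob (coloured_hitting_graph n)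
            {(E, c). zebraic_connected n E c}) \<longlonglongrightarrow> 1"
proof (rule tendsto_sandwich[where h = "\<lambda>_. 1"])
  define eps :: real where "eps = exp (- 8000)"
  have eps: "0 < eps" "eps \<le> 1 / 4"
  proof -
    show "0 < eps" by (simp add: eps_def)
    have "4 \<le> exp (8000 :: real)"
      using exp_ge_add_one_self[of "8000 :: real"] by simp
    then show "eps \<le> 1 / 4"
      by (simp add: eps_def exp_minus field_simps)
  qed
  have "eventually (\<lambda>n. 16 \<le> eps * real n) sequentially"
    using eps(1) by real_asymp
  \<comment> \<open>The last two conditions are \<open>rd\<close> and \<open>d4\<close> of
    \<open>spread_graph\<close>: 0.008 ln n \<le> 0.01 ln n - 2 holds once ln n is at least
    1000.\<close>
  moreover have "eventually (\<lambda>n. 2 \<le> n \<and> 0.9 * ln n / real n < 1 \<and> 2 * ln n / real n \<le> 1 \<and>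
      16 * (ln n / 2000) \<le> ln n / 100 - 2 \<and> 4 < ln n / 100) sequentially"
    by (intro eventually_conj eventually_ge_at_top; real_asymp)
  ultimately show "eventually (\<lambda>n. 1 - defect n \<le> measure_pmf.prob (coloured_hitting_graph n)
      {(E, c). zebraic_connected n E c}) sequentially"
  proof eventually_elim
    case (elim n)
    let ?tame = "tame n (ln n / 100) (ln n / 2000) eps"
    have "measure_pmf.prob (coloured_hitting_graph n) {(E, c). \<not> zebraic_connected n E c} \<le>
        measure_pmf.prob (edge_model n (0.9 * ln n / n) (2 * ln n / n)) {\<omega>. \<not> ?tame \<omega>}"
    proof (rule prob_not_zebraic_le)
      show "\<not> min_deg_ge1 n (early n \<omega>) \<and> min_deg_ge1 n (timely n \<omega>)" if "?tame \<omega>" for \<omega>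
        using that by (simp add: tame_def)
      show "zebraic_connected n E (snd \<circ> \<omega>)"
        if "?tame \<omega>" "early n \<omega> \<subseteq> E" "E \<subseteq> timely n \<omega>" "min_deg_ge1 n E" for \<omega> E
        by (rule spread_graph.zebraic_connected, rule tame_spread_graph[OF that]) (use elim eps in auto)
    qed
    also have "\<dots> \<le> defect n"
      unfolding eps_def by (rule prob_not_tame_le) (use elim in auto)
    finally have "measure_pmf.prob (coloured_hitting_graph n) {(E, c). \<not> zebraic_connected n E c} \<le> defect n" .
    moreover have "{(E, c). \<not> zebraic_connected n E c} = UNIV - {(E, c). zebraic_connected n E c}"
      by auto
    ultimately have "1 - measure_pmf.prob (coloured_hitting_graph n) {(E, c). zebraic_connected n E c} \<le> defect n"
      by (simp only: prob_UNIV_diff)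
    then show ?case
      by simp
  qed
  show "(\<lambda>n. 1 - defect n) \<longlonglongrightarrow> 1"
    using tendsto_diff[OF tendsto_const defect_tendsto_0, of 1] by simp
qed simp_all

end
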